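(* Let $k$ be a field, $n\ge 1$, $K_n=k[x_1^{\pm1},\dots,x_n^{\pm1}]$, and let $\delta=\sum_{i=1}^n g_i\frac{\partial}{\partial x_i}$ with $g_i\in kx_i+k$ be a $k$-derivation of $K_n$ such that the Ore extension $R_{n+1}=K_n[x,\delta]$ is a simple ring. Let $N$ be a cyclic $K_n$-submodule of a right $R_{n+1}$-module $M$. Then $$\mathrm{GKdim}\,(N\otimes_{K_n}R_{n+1})=\mathrm{GKdim}(N)+1,$$ where the left-hand side is the Gelfand–Kirillov dimension of $N\otimes_{K_n}R_{n+1}$ as a right $R_{n+1}$-module and $\mathrm{GKdim}(N)$ is the Gelfand–Kirillov dimension of $N$ as a $K_n$-module.
   Context: All modules are right modules. $K_n[x,\delta]$ is the Ore extension (differential operator ring): it is free as a left $K_n$-module on $1,x,x^2,\dots$, with multiplication determined by $xa=ax+\delta(a)$ for $a\in K_n$. Gelfand–Kirillov dimension: let $A$ be a finitely generated (affine) $k$-algebra with finite generating set $\{a_1,\dots,a_s\}$ containing $1$. Put $A_0=k$, $A_1=\sum_{j} k a_j$, $A_m=A_1^m$. For a finitely generated right $A$-module $Q$ with finite-dimensional generating subspace $Q_0$, set $Q_m=Q_0A_m$. Then $\mathrm{GKdim}(Q)=\limsup_{m\to\infty}\log_m(\dim_k Q_m)$; it does not depend on the choice of generating set or of $Q_0$. Here $\log 0=-\infty$, so the zero module has GK dimension $-\infty$ (and $-\infty+1=-\infty$). *)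

theory Defs
  imports
    "HOL-Library.Function_Algebras"
    "HOL-Library.Extended_Real"
    "HOL-Library.Liminf_Limsup"
    "HOL-Computational_Algebra.Polynomial"
    "HOL-Algebra.Algebraic_Closure_Type"
    "HOL-Algebra.Free_Abelian_Groups"
    "Jordan_Normal_Form.Missing_VectorSpace"
begin

section \<open>Laurent polynomials and derivations\<close>

text \<open>
  The Laurent polynomial ring in variables indexed by the finite type \<open>'n\<close> is the group
  algebra of the exponent group; the ring operations are the convolution operations of
  \<^theory>\<open>HOL-Library.Poly_Mapping\<close>.
\<close>

type_synonym ('k, 'n) laurent = "('n \<Rightarrow> int) \<Rightarrow>\<^sub>0 'k"

definition unit_exp :: "'n \<Rightarrow> 'n \<Rightarrow> int" where
  "unit_exp i = (\<lambda>j. if j = i then 1 else 0)"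

definition lconst :: "'k \<Rightarrow> ('k::comm_ring_1, 'n) laurent" where
  "lconst c = Poly_Mapping.single 0 c"

definition lvar :: "'n \<Rightarrow> ('k::comm_ring_1, 'n) laurent" where
  "lvar i = Poly_Mapping.single (unit_exp i) 1"

definition lpartial :: "'n \<Rightarrow> ('k::comm_ring_1, 'n) laurent \<Rightarrow> ('k, 'n) laurent" where
  "lpartial i p =
     (\<Sum>e\<in>Poly_Mapping.keys p.
        Poly_Mapping.single (e - unit_exp i) (of_int (e i) * Poly_Mapping.lookup p e))"


section \<open>Ore extensions of derivation type\<close>

text \<open>
  An element $\sum_i a_i x^i$ of $K[x,\delta]$, with coefficients on the left, is represented
  by the polynomial with coefficients $a_i$.  The rule $xa = ax + \delta(a)$ says that left
  multiplication by $x$ maps $\sum_j b_j x^j$ to $\sum_j (b_j x^{j+1} + \delta(b_j) x^j)$,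
  and $(\sum_i a_i x^i) q = \sum_i a_i (x^i q)$.
\<close>

definition ore_lmult_x ::
    "('a \<Rightarrow> 'a) \<Rightarrow> 'a::comm_ring_1 Polynomial.poly \<Rightarrow> 'a Polynomial.poly" where
  "ore_lmult_x \<delta> q = pCons 0 q + map_poly \<delta> q"

definition ore_mult ::
    "('a \<Rightarrow> 'a) \<Rightarrow> 'a::comm_ring_1 Polynomial.poly \<Rightarrow> 'a Polynomial.poly \<Rightarrow> 'a Polynomial.poly"
  where
  "ore_mult \<delta> p q =
     (\<Sum>i\<le>Polynomial.degree p. Polynomial.smult (Polynomial.coeff p i) ((ore_lmult_x \<delta> ^^ i) q))"

definition ore_extension :: "('a \<Rightarrow> 'a) \<Rightarrow> 'a::comm_ring_1 Polynomial.poly ring" where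
  "ore_extension \<delta> =
     \<lparr>carrier = UNIV, monoid.mult = ore_mult \<delta>, one = 1, ring.zero = 0, ring.add = (+)\<rparr>"

definition ore_const :: "'a \<Rightarrow> 'a::comm_ring_1 Polynomial.poly" where
  "ore_const a = [:a:]"

definition simple_ring :: "('a, 'c) ring_scheme \<Rightarrow> bool" where
  "simple_ring R \<longleftrightarrow>
     ring R \<and> carrier R \<noteq> {\<zero>\<^bsub>R\<^esub>} \<and> (\<forall>I. ideal I R \<longrightarrow> I = {\<zero>\<^bsub>R\<^esub>} \<or> I = carrier R)"


section \<open>Right modules\<close>

text \<open>
  As in \<^theory>\<open>HOL-Algebra.Module\<close>, the multiplicative fields inherited from the ring record
  carry no meaning in a module.
\<close>

record ('a, 'b) rmodule = "'b ring" +
  ract :: "'b \<Rightarrow> 'a \<Rightarrow> 'b" (infixl "\<triangleleft>\<index>" 70)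

locale right_module = A?: ring A + Q?: abelian_group Q
  for A :: "('a, 'c) ring_scheme" (structure) and Q :: "('a, 'b, 'd) rmodule_scheme" (structure) +
  assumes ract_closed:
      "\<lbrakk>q \<in> carrier Q; a \<in> carrier A\<rbrakk> \<Longrightarrow> q \<triangleleft>\<^bsub>Q\<^esub> a \<in> carrier Q"
    and ract_add_left:
      "\<lbrakk>p \<in> carrier Q; q \<in> carrier Q; a \<in> carrier A\<rbrakk> \<Longrightarrow>
         (p \<oplus>\<^bsub>Q\<^esub> q) \<triangleleft>\<^bsub>Q\<^esub> a = p \<triangleleft>\<^bsub>Q\<^esub> a \<oplus>\<^bsub>Q\<^esub> q \<triangleleft>\<^bsub>Q\<^esub> a"
    and ract_add_right:
      "\<lbrakk>q \<in> carrier Q; a \<in> carrier A; b \<in> carrier A\<rbrakk> \<Longrightarrow>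
         q \<triangleleft>\<^bsub>Q\<^esub> (a \<oplus>\<^bsub>A\<^esub> b) = q \<triangleleft>\<^bsub>Q\<^esub> a \<oplus>\<^bsub>Q\<^esub> q \<triangleleft>\<^bsub>Q\<^esub> b"
    and ract_assoc:
      "\<lbrakk>q \<in> carrier Q; a \<in> carrier A; b \<in> carrier A\<rbrakk> \<Longrightarrow>
         q \<triangleleft>\<^bsub>Q\<^esub> (a \<otimes>\<^bsub>A\<^esub> b) = (q \<triangleleft>\<^bsub>Q\<^esub> a) \<triangleleft>\<^bsub>Q\<^esub> b"
    and ract_one:
      "q \<in> carrier Q \<Longrightarrow> q \<triangleleft>\<^bsub>Q\<^esub> \<one>\<^bsub>A\<^esub> = q"

definition regular_rmodule :: "('a, 'c) ring_scheme \<Rightarrow> ('a, 'a) rmodule" where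
  "regular_rmodule A =
     \<lparr>carrier = carrier A, monoid.mult = monoid.mult A, one = one A,
      ring.zero = ring.zero A, ring.add = ring.add A,
      ract = monoid.mult A\<rparr>"

definition restrict_scalars :: "('a \<Rightarrow> 'r) \<Rightarrow> ('r, 'b) rmodule \<Rightarrow> ('a, 'b) rmodule" where
  "restrict_scalars \<phi> Q =
     \<lparr>carrier = carrier Q, monoid.mult = monoid.mult Q, one = one Q,
      ring.zero = ring.zero Q, ring.add = ring.add Q,
      ract = (\<lambda>q a. q \<triangleleft>\<^bsub>Q\<^esub> \<phi> a)\<rparr>"

definition right_submodule ::
    "('a, 'c) ring_scheme \<Rightarrow> 'b set \<Rightarrow> ('a, 'b) rmodule \<Rightarrow> bool" where
  "right_submodule A N Q \<longleftrightarrow>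
     subgroup N (add_monoid Q) \<and> (\<forall>v\<in>N. \<forall>a\<in>carrier A. v \<triangleleft>\<^bsub>Q\<^esub> a \<in> N)"

definition cyclic_right_submodule ::
    "('a, 'c) ring_scheme \<Rightarrow> 'b set \<Rightarrow> ('a, 'b) rmodule \<Rightarrow> bool" where
  "cyclic_right_submodule A N Q \<longleftrightarrow>
     right_submodule A N Q \<and> (\<exists>v\<in>N. N = (\<lambda>a. v \<triangleleft>\<^bsub>Q\<^esub> a) ` carrier A)"


section \<open>Tensor products\<close>

text \<open>
  For a ring homomorphism $\phi : A \to B$ and a right $A$-module $N$, the right $B$-module
  $N \otimes_A B$, where $B$ is a left $A$-module via $\phi$: the free abelian group on
  $N \times B$ modulo the subgroup generated by the bilinearity and balancing relations.
\<close>

definition tensor_free ::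
    "('r, 'd) ring_scheme \<Rightarrow> ('a, 'b) rmodule \<Rightarrow> ('b \<times> 'r \<Rightarrow>\<^sub>0 int) monoid" where
  "tensor_free B N = free_Abelian_group (carrier N \<times> carrier B)"

definition tensor_relations ::
    "('a, 'c) ring_scheme \<Rightarrow> ('a \<Rightarrow> 'r) \<Rightarrow> ('r, 'd) ring_scheme \<Rightarrow> ('a, 'b) rmodule
      \<Rightarrow> ('b \<times> 'r \<Rightarrow>\<^sub>0 int) set" where
  "tensor_relations A \<phi> B N =
     {frag_of (u \<oplus>\<^bsub>N\<^esub> v, b) - frag_of (u, b) - frag_of (v, b) | u v b.
        u \<in> carrier N \<and> v \<in> carrier N \<and> b \<in> carrier B} \<union>
     {frag_of (v, b \<oplus>\<^bsub>B\<^esub> c) - frag_of (v, b) - frag_of (v, c) | v b c.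
        v \<in> carrier N \<and> b \<in> carrier B \<and> c \<in> carrier B} \<union>
     {frag_of (v \<triangleleft>\<^bsub>N\<^esub> a, b) - frag_of (v, \<phi> a \<otimes>\<^bsub>B\<^esub> b) | v a b.
        v \<in> carrier N \<and> a \<in> carrier A \<and> b \<in> carrier B}"

definition tensor_kernel ::
    "('a, 'c) ring_scheme \<Rightarrow> ('a \<Rightarrow> 'r) \<Rightarrow> ('r, 'd) ring_scheme \<Rightarrow> ('a, 'b) rmodule
      \<Rightarrow> ('b \<times> 'r \<Rightarrow>\<^sub>0 int) set" where
  "tensor_kernel A \<phi> B N = generate (tensor_free B N) (tensor_relations A \<phi> B N)"

text \<open>
  The action is $(v \otimes b) c = v \otimes bc$ on pure tensors.  The image of a coset under
  the induced map on the free abelian group lies in a single coset; adding the subgroup of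
  relations back yields that whole coset.
\<close>

definition tensor_rmodule ::
    "('a, 'c) ring_scheme \<Rightarrow> ('a \<Rightarrow> 'r) \<Rightarrow> ('r, 'd) ring_scheme \<Rightarrow> ('a, 'b) rmodule
      \<Rightarrow> ('r, ('b \<times> 'r \<Rightarrow>\<^sub>0 int) set) rmodule" where
  "tensor_rmodule A \<phi> B N =
     (let F = tensor_free B N; H = tensor_kernel A \<phi> B N in
      \<lparr>carrier = carrier (F Mod H), monoid.mult = undefined, one = undefined,
       ring.zero = \<one>\<^bsub>F Mod H\<^esub>, ring.add = monoid.mult (F Mod H),
       ract = (\<lambda>w c. set_mult F H (frag_extend (\<lambda>(v, b). frag_of (v, b \<otimes>\<^bsub>B\<^esub> c)) ` w))\<rparr>)"


section \<open>Gelfand--Kirillov dimension\<close>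

text \<open>
  A $k$-algebra is given by a field \<open>K\<close>, a ring \<open>A\<close> and the structure map \<open>\<eta>\<close> from \<open>K\<close>
  to \<open>A\<close>.  A right \<open>A\<close>-module becomes a vector space over \<open>K\<close> through \<open>\<eta>\<close>.
\<close>

definition scalar_space :: "('k \<Rightarrow> 'a) \<Rightarrow> ('a, 'b) rmodule \<Rightarrow> ('k, 'b) module" where
  "scalar_space \<eta> Q =
     \<lparr>carrier = carrier Q, monoid.mult = monoid.mult Q, one = one Q,
      ring.zero = ring.zero Q, ring.add = ring.add Q,
      module.smult = (\<lambda>c q. q \<triangleleft>\<^bsub>Q\<^esub> \<eta> c)\<rparr>"

definition kspan :: "('k, 'e) ring_scheme \<Rightarrow> ('k \<Rightarrow> 'a) \<Rightarrow> ('a, 'b) rmodule \<Rightarrow> 'b set \<Rightarrow> 'b set"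
  where "kspan K \<eta> Q S = LinearCombinations.module.span K (scalar_space \<eta> Q) S"

definition kdim :: "('k, 'e) ring_scheme \<Rightarrow> ('k \<Rightarrow> 'a) \<Rightarrow> ('a, 'b) rmodule \<Rightarrow> 'b set \<Rightarrow> nat"
  where "kdim K \<eta> Q V = vectorspace.dim K ((scalar_space \<eta> Q)\<lparr>carrier := V\<rparr>)"

definition finite_dim_subspace ::
    "('k, 'e) ring_scheme \<Rightarrow> ('k \<Rightarrow> 'a) \<Rightarrow> ('a, 'b) rmodule \<Rightarrow> 'b set \<Rightarrow> bool" where
  "finite_dim_subspace K \<eta> Q V \<longleftrightarrow>
     VectorSpace.subspace K V (scalar_space \<eta> Q) \<and>
     vectorspace.fin_dim K ((scalar_space \<eta> Q)\<lparr>carrier := V\<rparr>)"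

text \<open>The product $VX$ of a subset $V$ of $Q$ and a subset $S$ of $A$.\<close>

definition prod_space ::
    "('k, 'e) ring_scheme \<Rightarrow> ('k \<Rightarrow> 'a) \<Rightarrow> ('a, 'b) rmodule \<Rightarrow> 'b set \<Rightarrow> 'a set \<Rightarrow> 'b set" where
  "prod_space K \<eta> Q V S = kspan K \<eta> Q {v \<triangleleft>\<^bsub>Q\<^esub> a | v a. v \<in> V \<and> a \<in> S}"

primrec alg_filtration ::
    "('k, 'e) ring_scheme \<Rightarrow> ('k \<Rightarrow> 'a) \<Rightarrow> ('a, 'c) ring_scheme \<Rightarrow> 'a set \<Rightarrow> nat \<Rightarrow> 'a set" where
  "alg_filtration K \<eta> A S 0 = \<eta> ` carrier K"
| "alg_filtration K \<eta> A S (Suc m) =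
     prod_space K \<eta> (regular_rmodule A)
       (alg_filtration K \<eta> A S m) (kspan K \<eta> (regular_rmodule A) S)"

definition alg_generating_set ::
    "('k, 'e) ring_scheme \<Rightarrow> ('k \<Rightarrow> 'a) \<Rightarrow> ('a, 'c) ring_scheme \<Rightarrow> 'a set \<Rightarrow> bool" where
  "alg_generating_set K \<eta> A S \<longleftrightarrow>
     finite S \<and> S \<subseteq> carrier A \<and> \<one>\<^bsub>A\<^esub> \<in> S \<and> (\<Union>m. alg_filtration K \<eta> A S m) = carrier A"

definition generating_subspace ::
    "('k, 'e) ring_scheme \<Rightarrow> ('k \<Rightarrow> 'a) \<Rightarrow> ('a, 'c) ring_scheme \<Rightarrow> ('a, 'b) rmodule
      \<Rightarrow> 'b set \<Rightarrow> bool" where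
  "generating_subspace K \<eta> A Q V \<longleftrightarrow>
     finite_dim_subspace K \<eta> Q V \<and> prod_space K \<eta> Q V (carrier A) = carrier Q"

definition log_dim :: "nat \<Rightarrow> nat \<Rightarrow> ereal" where
  "log_dim m d = (if d = 0 then -\<infinity> else ereal (log (real m) (real d)))"

definition gkdim_wrt ::
    "('k, 'e) ring_scheme \<Rightarrow> ('k \<Rightarrow> 'a) \<Rightarrow> ('a, 'c) ring_scheme \<Rightarrow> ('a, 'b) rmodule
      \<Rightarrow> 'a set \<Rightarrow> 'b set \<Rightarrow> ereal" where
  "gkdim_wrt K \<eta> A Q S V =
     limsup (\<lambda>m. log_dim m (kdim K \<eta> Q (prod_space K \<eta> Q V (alg_filtration K \<eta> A S m))))"

text \<open>
  The growth exponent does not depend on the generators, so any choice of them may be used.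
  The definition is meaningful for finitely generated modules over affine algebras only.
\<close>

definition gkdim ::
    "('k, 'e) ring_scheme \<Rightarrow> ('k \<Rightarrow> 'a) \<Rightarrow> ('a, 'c) ring_scheme \<Rightarrow> ('a, 'b) rmodule \<Rightarrow> ereal" where
  "gkdim K \<eta> A Q =
     (SOME d. \<exists>S V. alg_generating_set K \<eta> A S \<and> generating_subspace K \<eta> A Q V \<and>
        d = gkdim_wrt K \<eta> A Q S V)"

end

theory Submission
  imports Defs "HOL-Analysis.Extended_Real_Limits" "HOL-Real_Asymp.Real_Asymp"
begin

text \<open>
  Write \<open>A\<close> for the coefficient ring, \<open>A\<^sub>m\<close> for the powers of a finite-dimensional generating
  space of \<open>A\<close>, \<open>N = vA\<close> for the cyclic module and \<open>d m = dim vA\<^sub>m\<close> for its growth function.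
  Since \<open>A[x,\<delta>]\<close> is free as a left \<open>A\<close>-module on the powers of \<open>x\<close>, the induced module is
  \<open>\<Oplus>\<^sub>j N \<otimes> x\<^sup>j\<close>.  The image of \<open>v \<otimes> 1\<close> under the \<open>m\<close>-th power of the space spanned by \<open>x\<close> and
  the generators of \<open>A\<close> is compared with spaces \<open>\<Oplus>\<^sub>j\<^sub>\<le>\<^sub>s U \<otimes> x\<^sup>j\<close>, which have dimension
  \<open>(s + 1) dim U\<close> (\<open>initial_dim\<close>):

  \<^item> It contains such a space with \<open>s\<close> about \<open>m / 2\<close> and \<open>U = vA\<^sub>s\<close>, because \<open>A\<^sub>i x\<^sup>j\<close> lies in the
    power \<open>i + j\<close> (\<open>monom_in_E\<close>).

  \<^item> It is contained in such a space with \<open>s = m\<close> and \<open>U = vA\<^sub>w\<^sub>m\<close> for a constant \<open>w\<close>.  Moving \<open>x\<close> past a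
    coefficient creates terms in which \<open>x\<close> is replaced by an application of \<open>\<delta>\<close>; as \<open>\<delta>\<close> is a
    derivation, it raises the filtration degree by at most a constant (\<open>\<delta>_bounded\<close>).  Giving \<open>x\<close>
    a larger weight than this constant therefore makes the weighted degree subadditive
    (\<open>E_weighted\<close>).

  So the growth function of the induced module lies, up to linear changes of the argument, between
  two copies of \<open>(m + 1) d m\<close>.  Such changes do not affect the growth exponent
  (\<open>limsup_log_dim_reparam\<close>), and the factor \<open>m + 1\<close> raises it by one
  (\<open>limsup_log_dim_times_Suc\<close>), also in the degenerate case \<open>N = 0\<close>, where it is \<open>-\<infinity>\<close>.

  The same insensitivity to linear changes shows that the growth exponent is independent of the
  generators (\<open>gkdim_eq\<close>), so that both sides may be computed with the generators above.  The
  decomposition of the induced module rests on the universal property of the tensor product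
  (\<open>tensor_universal\<close>), which provides the coordinate maps \<open>v \<otimes> p \<mapsto> v p\<^sub>j\<close>.
\<close>

section \<open>Growth exponents\<close>

text \<open>The factor \<open>m + 1\<close> contributes \<open>log\<^sub>m (m + 1)\<close>, which tends to \<open>1\<close>.\<close>

lemma limsup_log_dim_times_Suc:
  "limsup (\<lambda>m. log_dim m (Suc m * d m)) = limsup (\<lambda>m. log_dim m (d m)) + 1"
proof -
  have "(\<lambda>m. log (real m) (real (Suc m))) \<longlonglongrightarrow> 1"
    by real_asymp
  hence lim: "(\<lambda>m. ereal (log (real m) (real (Suc m)))) \<longlonglongrightarrow> 1"
    by (simp add: one_ereal_def)
  have "log_dim m (Suc m * d m) = ereal (log (real m) (real (Suc m))) + log_dim m (d m)" for m
  proof (cases "d m = 0")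
    case False
    hence "log (real m) (real (Suc m) * real (d m)) =
        log (real m) (real (Suc m)) + log (real m) (real (d m))"
      by (subst log_mult) auto
    with False show ?thesis
      unfolding log_dim_def of_nat_mult by simp
  qed (simp add: log_dim_def)
  hence "limsup (\<lambda>m. log_dim m (Suc m * d m)) =
      limsup (\<lambda>m. ereal (log (real m) (real (Suc m))) + log_dim m (d m))"
    by simp
  also have "\<dots> = 1 + limsup (\<lambda>m. log_dim m (d m))"
    by (rule ereal_limsup_lim_add[OF lim]) simp
  finally show ?thesis
    by (simp add: add.commute)
qed

text \<open>
  A linear change of the argument turns a bound \<open>m powr b\<close> into \<open>(t * m + s) powr b\<close>, which is
  eventually below \<open>m powr c\<close> for every \<open>c > b\<close>.
\<close>

lemma limsup_log_dim_reparam: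
  fixes f h :: "nat \<Rightarrow> nat"
  assumes fh: "\<And>m. f m \<le> h (t * m + s)" and "mono h"
  shows "limsup (\<lambda>m. log_dim m (f m)) \<le> limsup (\<lambda>m. log_dim m (h m))"
proof (cases "\<exists>m. h m > 0")
  case False
  with fh have "f m \<le> h m" for m
    by (metis le_zero_eq not_gr_zero)
  with False show ?thesis
    by (intro Limsup_mono always_eventually allI) (auto simp: log_dim_def)
next
  case True
  define L where "L = limsup (\<lambda>m. log_dim m (h m))"
  from True obtain m\<^sub>0 where m0: "h m\<^sub>0 > 0" by blast
  have hpos: "h m > 0" if "m \<ge> m\<^sub>0" for m
    using m0 monoD[OF \<open>mono h\<close> that] by linarith
  have ev0: "\<forall>\<^sub>F m in sequentially. 0 \<le> log_dim m (h m)"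
    using eventually_ge_at_top[of "max 2 m\<^sub>0"]
    by eventually_elim (use hpos in \<open>auto simp: log_dim_def Suc_le_eq\<close>)
  hence L0: "0 \<le> L"
    unfolding L_def by (intro le_Limsup) auto
  have "limsup (\<lambda>m. log_dim m (f m)) \<le> y" if y: "L < y" for y
  proof (cases y)
    case (real c)
    obtain b where b: "L < ereal b" "b < c"
      using y real ereal_dense2[of L y] by auto
    hence "b > 0"
      using L0 by (metis ereal_less(2) order.strict_trans1)
    have "\<forall>\<^sub>F m in sequentially. log_dim m (h m) < ereal b"
      using b(1) unfolding L_def by (metis Limsup_lessD)
    then obtain m\<^sub>1 where m1: "\<And>m. m \<ge> m\<^sub>1 \<Longrightarrow> log_dim m (h m) < ereal b"
      unfolding eventually_sequentially by blast
    have hb: "real (h m) \<le> real m powr b" if "m \<ge> max 2 m\<^sub>1" for m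
    proof (cases "h m = 0")
      case False
      thus ?thesis
        using m1[of m] that by (auto simp: log_dim_def log_less_iff)
    qed auto
    \<comment> \<open>A positive slope, so that \<open>t' * m + s\<close> exceeds \<open>m\<^sub>1\<close> for large \<open>m\<close> even if \<open>t = 0\<close>.\<close>
    define t' where "t' = Suc t"
    have asymp: "\<forall>\<^sub>F m in sequentially. (real t' * real m + real s) powr b \<le> real m powr c"
      using b(2) \<open>b > 0\<close> unfolding t'_def by real_asymp
    have "\<forall>\<^sub>F m in sequentially. log_dim m (f m) \<le> ereal c"
      using asymp eventually_ge_at_top[of "max 2 m\<^sub>1"]
    proof eventually_elim
      case (elim m)
      have "f m \<le> h (t' * m + s)"
        using fh[of m] monoD[OF \<open>mono h\<close>, of "t * m + s" "t' * m + s"] by (simp add: t'_def)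
      also have "real (h (t' * m + s)) \<le> real (t' * m + s) powr b"
        using elim by (intro hb) (auto simp: t'_def)
      also have "\<dots> \<le> real m powr c"
        using elim by simp
      finally have "real (f m) \<le> real m powr c" by simp
      with elim show ?case
        by (auto simp: log_dim_def log_le_iff)
    qed
    thus ?thesis
      using real by (simp add: Limsup_bounded)
  qed (use y in auto)
  thus ?thesis
    unfolding L_def[symmetric] by (meson dense_ge)
qed

section \<open>Dimension counts\<close>

context vectorspace
begin

lemma fin_dim_subspace_iff:
  assumes "subspace K U V"
  shows "vectorspace.fin_dim K (vs U) \<longleftrightarrow> (\<exists>B. finite B \<and> B \<subseteq> carrier V \<and> span B = U)"
proof -
  interpret U: vectorspace K "vs U"
    by (rule subspace_is_vs[OF assms])
  have sub: "submodule K U V" and "U \<subseteq> carrier V"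
    using assms by (auto simp: subspace_def submodule_def)
  have "B \<subseteq> U" if "B \<subseteq> carrier V" "span B = U" for B
    using in_own_span[OF that(1)] that(2) by simp
  thus ?thesis
    unfolding U.fin_dim_def using span_li_not_depend(1)[OF _ sub] \<open>U \<subseteq> carrier V\<close>
    by (metis carrier_vs_is_self order_trans)
qed

lemma dim_subspace_mono:
  assumes U: "subspace K U V" "vectorspace.fin_dim K (vs U)"
    and W: "subspace K W V" "vectorspace.fin_dim K (vs W)"
    and "U \<subseteq> W"
  shows "vectorspace.dim K (vs U) \<le> vectorspace.dim K (vs W)"
proof -
  interpret U: vectorspace K "vs U" by (rule subspace_is_vs[OF U(1)])
  interpret W: vectorspace K "vs W" by (rule subspace_is_vs[OF W(1)])
  have subs: "submodule K U V" "submodule K W V"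
    using U W by (auto simp: subspace_def)
  obtain A where A: "finite A" "U.basis A"
    using U.finite_basis_exists[OF U(2)] by blast
  have "A \<subseteq> U" "U.lin_indpt A"
    using A by (auto simp: U.basis_def)
  hence "W.lin_indpt A"
    using span_li_not_depend(2) subs \<open>U \<subseteq> W\<close> by (metis order_trans)
  hence "card A \<le> W.dim"
    using W.li_le_dim(2)[OF W(2)] \<open>A \<subseteq> U\<close> \<open>U \<subseteq> W\<close> by auto
  thus ?thesis
    using U.dim_basis[OF A] by simp
qed

end

text \<open>
  A vector space \<open>T\<close> that is the direct sum of copies of a space \<open>N\<close> indexed by the natural
  numbers, given by its projections \<open>\<theta>\<close> and its injections \<open>\<tau>\<close>.
\<close>

locale direct_sum_copies = T: vectorspace K T + N: vectorspace K N
  for K :: "('k, 'e) ring_scheme" (structure) and T :: "('k, 't, 'f) module_scheme"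
    and N :: "('k, 'n, 'g) module_scheme" +
  fixes \<theta> :: "nat \<Rightarrow> 't \<Rightarrow> 'n" and \<tau> :: "nat \<Rightarrow> 'n \<Rightarrow> 't"
  assumes \<theta>: "\<And>j. \<theta> j \<in> module_hom K T N"
    and \<tau>: "\<And>j. \<tau> j \<in> module_hom K N T"
    and \<theta>_\<tau>: "\<And>i j u. u \<in> carrier N \<Longrightarrow> \<theta> i (\<tau> j u) = (if i = j then u else \<zero>\<^bsub>N\<^esub>)"
    and \<theta>_inj: "\<And>t. t \<in> carrier T \<Longrightarrow> (\<And>j. \<theta> j t = \<zero>\<^bsub>N\<^esub>) \<Longrightarrow> t = \<zero>\<^bsub>T\<^esub>"
begin

text \<open>The sum of the copies of \<open>U\<close> in the first \<open>m\<close> summands.\<close>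

definition initial :: "nat \<Rightarrow> 'n set \<Rightarrow> 't set" where
  "initial m U = {t \<in> carrier T. \<forall>j. \<theta> j t \<in> (if j < m then U else {\<zero>\<^bsub>N\<^esub>})}"

lemma \<theta>_linear: "linear_map K T N (\<theta> j)" and \<tau>_linear: "linear_map K N T (\<tau> j)"
  by (unfold_locales; rule \<theta> \<tau>)+

lemma \<theta>_simps:
  "t \<in> carrier T \<Longrightarrow> \<theta> j t \<in> carrier N"
  "s \<in> carrier T \<Longrightarrow> t \<in> carrier T \<Longrightarrow> \<theta> j (s \<oplus>\<^bsub>T\<^esub> t) = \<theta> j s \<oplus>\<^bsub>N\<^esub> \<theta> j t"
  "c \<in> carrier K \<Longrightarrow> t \<in> carrier T \<Longrightarrow> \<theta> j (c \<odot>\<^bsub>T\<^esub> t) = c \<odot>\<^bsub>N\<^esub> \<theta> j t"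
  "\<theta> j \<zero>\<^bsub>T\<^esub> = \<zero>\<^bsub>N\<^esub>"
proof -
  interpret linear_map K T N "\<theta> j" by (rule \<theta>_linear)
  show "t \<in> carrier T \<Longrightarrow> \<theta> j t \<in> carrier N"
    "s \<in> carrier T \<Longrightarrow> t \<in> carrier T \<Longrightarrow> \<theta> j (s \<oplus>\<^bsub>T\<^esub> t) = \<theta> j s \<oplus>\<^bsub>N\<^esub> \<theta> j t"
    "c \<in> carrier K \<Longrightarrow> t \<in> carrier T \<Longrightarrow> \<theta> j (c \<odot>\<^bsub>T\<^esub> t) = c \<odot>\<^bsub>N\<^esub> \<theta> j t"
    "\<theta> j \<zero>\<^bsub>T\<^esub> = \<zero>\<^bsub>N\<^esub>"
    by (simp_all add: f_im)
qed

lemma \<tau>_closed: "u \<in> carrier N \<Longrightarrow> \<tau> j u \<in> carrier T"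
  using \<tau>[of j] by (auto dest: module_hom_closed)

lemma initial_subspace:
  assumes "subspace K U N"
  shows "subspace K (initial m U) T"
proof -
  have "submodule K (initial m U) T"
    using assms unfolding subspace_def submodule_def initial_def
    by (auto simp: \<theta>_simps T.module_axioms split: if_splits)
  thus ?thesis
    by (simp add: subspace_def T.vectorspace_axioms)
qed

text \<open>
  The projection \<open>\<theta> m\<close> maps \<open>initial (Suc m) U\<close> onto \<open>U\<close> with kernel \<open>initial m U\<close>, so the
  rank-nullity theorem gives the dimension by induction.  That theorem presupposes finite dimension,
  which is seen by splitting off the component \<open>\<tau> m (\<theta> m t)\<close>.
\<close>

lemma initial_dim:
  assumes U: "subspace K U N" "vectorspace.fin_dim K (N.vs U)"
  shows "vectorspace.fin_dim K (T.vs (initial m U)) \<and>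
         vectorspace.dim K (T.vs (initial m U)) = m * vectorspace.dim K (N.vs U)"
proof (induction m)
  case 0
  have 0: "initial 0 U = {\<zero>\<^bsub>T\<^esub>}"
    unfolding initial_def using \<theta>_inj by (auto simp: \<theta>_simps)
  interpret W: vectorspace K "T.vs (initial 0 U)"
    by (rule T.subspace_is_vs[OF initial_subspace[OF U(1)]])
  have gen: "W.gen_set {\<zero>\<^bsub>T.vs (initial 0 U)\<^esub>}"
    using W.span_is_subset2[of "{\<zero>\<^bsub>T\<^esub>}"] W.in_own_span[of "{\<zero>\<^bsub>T\<^esub>}"] by (auto simp: 0)
  have "W.fin_dim"
    unfolding W.fin_dim_def using gen by (intro exI[of _ "{\<zero>\<^bsub>T\<^esub>}"]) (auto simp: 0)
  with W.dim0I[OF gen] show ?case by simp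
next
  case (Suc m)
  interpret \<theta>: linear_map K T N "\<theta> m" by (rule \<theta>_linear)
  interpret W: vectorspace K "T.vs (initial (Suc m) U)"
    by (rule T.subspace_is_vs[OF initial_subspace[OF U(1)]])
  interpret U: vectorspace K "N.vs U"
    by (rule N.subspace_is_vs[OF U(1)])
  have UN: "U \<subseteq> carrier N" and U0: "\<zero>\<^bsub>N\<^esub> \<in> U"
    using U(1) by (auto simp: subspace_def submodule_def)
  have W_carrier: "initial (Suc m) U \<subseteq> carrier T"
    by (auto simp: initial_def)
  have hom: "\<theta> m \<in> module_hom K (T.vs (initial (Suc m) U)) (N.vs U)"
    unfolding module_hom_def by (auto simp: \<theta>_simps initial_def split: if_splits)
  interpret F: linear_map K "T.vs (initial (Suc m) U)" "N.vs U" "\<theta> m"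
    by unfold_locales (rule hom)
  have ker: "F.kerT = initial m U"
    unfolding F.ker_def unfolding initial_def by (auto simp: less_Suc_eq U0 split: if_splits)
  have \<tau>_in: "\<tau> m u \<in> initial (Suc m) U" if "u \<in> U" for u
    using that UN U0 by (auto simp: initial_def \<theta>_\<tau> \<tau>_closed)
  have \<theta>_in: "\<theta> m t \<in> U" if "t \<in> initial (Suc m) U" for t
    using that by (auto simp: initial_def dest: spec[of _ m])
  hence im: "F.imT = U"
  proof (intro equalityI)
    show "U \<subseteq> F.imT"
    proof
      fix u assume "u \<in> U"
      with \<tau>_in[OF this] UN show "u \<in> F.imT"
        unfolding F.im_def by (intro image_eqI[of _ _ "\<tau> m u"]) (auto simp: \<theta>_\<tau>)
    qed
  qed (auto simp: F.im_def)
  have fin: "W.fin_dim"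
  proof -
    obtain B where B: "finite B" "B \<subseteq> carrier T" "T.span B = initial m U"
      using Suc T.fin_dim_subspace_iff[OF initial_subspace[OF U(1)]] by blast
    obtain C where C: "finite C" "C \<subseteq> carrier N" "N.span C = U"
      using U N.fin_dim_subspace_iff by blast
    define D where "D = B \<union> \<tau> m ` C"
    have D: "finite D" "D \<subseteq> carrier T"
      using B C by (auto simp: D_def \<tau>_closed)
    have D_sub: "submodule K (T.span D) T"
      by (rule T.span_is_submodule[OF D(2)])
    have CU: "C \<subseteq> U"
      using C N.in_own_span by blast
    have mono: "initial m U \<subseteq> initial (Suc m) U"
      using U0 by (auto simp: initial_def less_Suc_eq split: if_splits)
    have "D \<subseteq> initial (Suc m) U"
      using B T.in_own_span[OF B(2)] mono CU \<tau>_in by (auto simp: D_def)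
    hence "T.span D \<subseteq> initial (Suc m) U"
      using initial_subspace[OF U(1), of "Suc m"]
      by (intro T.span_is_subset) (auto simp: subspace_def)
    moreover have "initial (Suc m) U \<subseteq> T.span D"
    proof
      fix t assume t: "t \<in> initial (Suc m) U"
      interpret S: linear_map K N T "\<tau> m" by (rule \<tau>_linear)
      have "N.span C \<subseteq> {u \<in> carrier N. \<tau> m u \<in> T.span D}"
      proof (rule N.span_is_subset)
        show "C \<subseteq> {u \<in> carrier N. \<tau> m u \<in> T.span D}"
          using C T.in_own_span[OF D(2)] by (auto simp: D_def)
        show "submodule K {u \<in> carrier N. \<tau> m u \<in> T.span D} N"
          using D_sub unfolding submodule_def by (auto simp: N.module_axioms)
      qed
      hence \<tau>U: "\<tau> m u \<in> T.span D" if "u \<in> U" for u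
        using that C by auto
      define u where "u = \<theta> m t"
      have u: "u \<in> U" "t \<in> carrier T" "u \<in> carrier N" "\<tau> m u \<in> carrier T"
        using \<theta>_in[OF t] W_carrier t UN \<tau>_closed by (auto simp: u_def)
      define s where "s = t \<ominus>\<^bsub>T\<^esub> \<tau> m u"
      have s: "s \<in> carrier T"
        using u by (simp add: s_def)
      have \<theta>s: "\<theta> j s = (if j = m then \<zero>\<^bsub>N\<^esub> else \<theta> j t)" for j
      proof -
        interpret linear_map K T N "\<theta> j" by (rule \<theta>_linear)
        have "\<theta> j s = \<theta> j t \<ominus>\<^bsub>N\<^esub> (if j = m then u else \<zero>\<^bsub>N\<^esub>)"
          using u by (simp add: s_def f_minus \<theta>_\<tau>)
        thus ?thesis
          using u by (auto simp: u_def N.minus_eq N.r_neg N.add.inv_one \<theta>_simps)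
      qed
      have "\<theta> j s \<in> (if j < m then U else {\<zero>\<^bsub>N\<^esub>})" for j
        using t by (cases "j = m") (auto simp: \<theta>s initial_def less_Suc_eq dest: spec[of _ j])
      hence "s \<in> initial m U"
        using s by (simp add: initial_def)
      hence "s \<in> T.span B"
        using B by simp
      hence "s \<in> T.span D"
        using T.span_is_monotone[of B D] by (auto simp: D_def)
      moreover have "t = s \<oplus>\<^bsub>T\<^esub> \<tau> m u"
        using u by (simp add: s_def T.minus_eq T.a_assoc T.l_neg)
      ultimately show "t \<in> T.span D"
        using \<tau>U[OF u(1)] D_sub by (auto simp: submodule_def)
    qed
    ultimately show ?thesis
      using T.fin_dim_subspace_iff[OF initial_subspace[OF U(1)]] D by blast
  qed
  have "vectorspace.dim K (N.vs U) + vectorspace.dim K (T.vs (initial m U)) = W.dim"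
    using F.rank_nullity[OF fin] by (simp add: ker im)
  with Suc fin show ?case by simp
qed

end

section \<open>Growth of modules over an affine algebra\<close>

locale central_algebra = A?: ring A + K: field K
  for K :: "('k, 'e) ring_scheme" and \<eta> :: "'k \<Rightarrow> 'a" and A :: "('a, 'c) ring_scheme" +
  assumes \<eta>_hom: "\<eta> \<in> ring_hom K A"
    and \<eta>_central: "\<lbrakk>c \<in> carrier K; a \<in> carrier A\<rbrakk> \<Longrightarrow> \<eta> c \<otimes>\<^bsub>A\<^esub> a = a \<otimes>\<^bsub>A\<^esub> \<eta> c"

locale algebra_module = central_algebra K \<eta> A + right_module A Q
  for K :: "('k, 'e) ring_scheme" and \<eta> :: "'k \<Rightarrow> 'a" and A :: "('a, 'c) ring_scheme"
    and Q :: "('a, 'b) rmodule"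
begin

abbreviation ksubspace :: "'b set \<Rightarrow> bool" where
  "ksubspace U \<equiv> VectorSpace.subspace K U (scalar_space \<eta> Q)"

abbreviation span :: "'b set \<Rightarrow> 'b set" where
  "span \<equiv> kspan K \<eta> Q"

abbreviation prod :: "'b set \<Rightarrow> 'a set \<Rightarrow> 'b set" where
  "prod \<equiv> prod_space K \<eta> Q"

lemma \<eta>_closed: "c \<in> carrier K \<Longrightarrow> \<eta> c \<in> carrier A"
  using \<eta>_hom by (rule ring_hom_closed)

lemma scalar_space_simps:
  "carrier (scalar_space \<eta> Q) = carrier Q"
  "\<zero>\<^bsub>scalar_space \<eta> Q\<^esub> = \<zero>\<^bsub>Q\<^esub>"
  "u \<oplus>\<^bsub>scalar_space \<eta> Q\<^esub> v = u \<oplus>\<^bsub>Q\<^esub> v"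
  "c \<odot>\<^bsub>scalar_space \<eta> Q\<^esub> v = v \<triangleleft>\<^bsub>Q\<^esub> \<eta> c"
  by (simp_all add: scalar_space_def)

text \<open>Centrality of the scalars makes the action of every element of \<open>A\<close> linear.\<close>

lemma ract_scalar:
  assumes "v \<in> carrier Q" "c \<in> carrier K" "a \<in> carrier A"
  shows "(v \<triangleleft>\<^bsub>Q\<^esub> \<eta> c) \<triangleleft>\<^bsub>Q\<^esub> a = (v \<triangleleft>\<^bsub>Q\<^esub> a) \<triangleleft>\<^bsub>Q\<^esub> \<eta> c"
  using assms by (metis \<eta>_central \<eta>_closed ract_assoc)

lemma ract_zero: "a \<in> carrier A \<Longrightarrow> \<zero>\<^bsub>Q\<^esub> \<triangleleft>\<^bsub>Q\<^esub> a = \<zero>\<^bsub>Q\<^esub>"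
  by (metis Q.l_zero Q.add.l_cancel_one Q.zero_closed ract_add_left ract_closed)

lemma ract_zero_right: "v \<in> carrier Q \<Longrightarrow> v \<triangleleft>\<^bsub>Q\<^esub> \<zero>\<^bsub>A\<^esub> = \<zero>\<^bsub>Q\<^esub>"
  by (metis A.l_zero A.zero_closed Q.add.l_cancel_one ract_add_right ract_closed)

lemma scalar_vectorspace: "vectorspace K (scalar_space \<eta> Q)"
proof (rule vs_criteria)
  show "\<forall>v\<in>carrier (scalar_space \<eta> Q). \<exists>w\<in>carrier (scalar_space \<eta> Q).
      v \<oplus>\<^bsub>scalar_space \<eta> Q\<^esub> w = \<zero>\<^bsub>scalar_space \<eta> Q\<^esub>"
    using Q.r_neg Q.a_inv_closed by (auto simp: scalar_space_simps)
  show "\<forall>a b v. a \<in> carrier K \<and> b \<in> carrier K \<and> v \<in> carrier (scalar_space \<eta> Q) \<longrightarrow>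
      (a \<otimes>\<^bsub>K\<^esub> b) \<odot>\<^bsub>scalar_space \<eta> Q\<^esub> v =
      a \<odot>\<^bsub>scalar_space \<eta> Q\<^esub> (b \<odot>\<^bsub>scalar_space \<eta> Q\<^esub> v)"
  proof (intro allI impI)
    fix a b v assume "a \<in> carrier K \<and> b \<in> carrier K \<and> v \<in> carrier (scalar_space \<eta> Q)"
    hence "a \<in> carrier K" "b \<in> carrier K" "v \<in> carrier Q"
      by (auto simp: scalar_space_simps)
    thus "(a \<otimes>\<^bsub>K\<^esub> b) \<odot>\<^bsub>scalar_space \<eta> Q\<^esub> v =
        a \<odot>\<^bsub>scalar_space \<eta> Q\<^esub> (b \<odot>\<^bsub>scalar_space \<eta> Q\<^esub> v)"
      unfolding scalar_space_simps using ring_hom_mult[OF \<eta>_hom] \<eta>_closed ract_assoc ract_scalar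
      by metis
  qed
  show "\<forall>v\<in>carrier (scalar_space \<eta> Q). \<one>\<^bsub>K\<^esub> \<odot>\<^bsub>scalar_space \<eta> Q\<^esub> v = v"
    using ring_hom_one[OF \<eta>_hom] ract_one by (auto simp: scalar_space_simps)
  show "\<forall>a b v. a \<in> carrier K \<and> b \<in> carrier K \<and> v \<in> carrier (scalar_space \<eta> Q) \<longrightarrow>
      (a \<oplus>\<^bsub>K\<^esub> b) \<odot>\<^bsub>scalar_space \<eta> Q\<^esub> v =
      (a \<odot>\<^bsub>scalar_space \<eta> Q\<^esub> v) \<oplus>\<^bsub>scalar_space \<eta> Q\<^esub> (b \<odot>\<^bsub>scalar_space \<eta> Q\<^esub> v)"
    using ring_hom_add[OF \<eta>_hom] \<eta>_closed ract_add_right by (auto simp: scalar_space_simps)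
qed (auto simp: scalar_space_simps K.field_axioms \<eta>_closed ract_closed ract_add_left Q.a_assoc
    intro: Q.a_comm)

sublocale VS: vectorspace K "scalar_space \<eta> Q"
  by (rule scalar_vectorspace)

lemma ksubspace_iff:
  "ksubspace U \<longleftrightarrow> U \<subseteq> carrier Q \<and> \<zero>\<^bsub>Q\<^esub> \<in> U \<and>
     (\<forall>u\<in>U. \<forall>v\<in>U. u \<oplus>\<^bsub>Q\<^esub> v \<in> U) \<and> (\<forall>c\<in>carrier K. \<forall>u\<in>U. u \<triangleleft>\<^bsub>Q\<^esub> \<eta> c \<in> U)"
  unfolding subspace_def submodule_def
  by (auto simp: scalar_space_simps VS.vectorspace_axioms VS.module_axioms)

lemma span_subspace: "S \<subseteq> carrier Q \<Longrightarrow> ksubspace (span S)"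
  unfolding kspan_def using VS.span_is_subspace by (simp add: scalar_space_simps)

lemma span_least: "ksubspace U \<Longrightarrow> S \<subseteq> U \<Longrightarrow> span S \<subseteq> U"
  unfolding kspan_def subspace_def by (auto dest: VS.span_is_subset)

lemma span_superset: "S \<subseteq> carrier Q \<Longrightarrow> S \<subseteq> span S"
  unfolding kspan_def using VS.in_own_span by (simp add: scalar_space_simps)

lemma span_closed: "S \<subseteq> carrier Q \<Longrightarrow> span S \<subseteq> carrier Q"
  using span_subspace by (auto simp: ksubspace_iff)

lemma finite_dim_subspace_iff:
  "finite_dim_subspace K \<eta> Q U \<longleftrightarrow> (\<exists>B. finite B \<and> B \<subseteq> carrier Q \<and> span B = U)"
  unfolding finite_dim_subspace_def
  using VS.fin_dim_subspace_iff[of U] span_subspace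
  by (auto simp: scalar_space_simps kspan_def)

lemma kdim_mono:
  assumes "finite_dim_subspace K \<eta> Q U" "finite_dim_subspace K \<eta> Q W" "U \<subseteq> W"
  shows "kdim K \<eta> Q U \<le> kdim K \<eta> Q W"
  using assms VS.dim_subspace_mono unfolding finite_dim_subspace_def kdim_def by blast

lemma ksubspace_preimage_ract:
  assumes "ksubspace U" "a \<in> carrier A"
  shows "ksubspace {v \<in> carrier Q. v \<triangleleft>\<^bsub>Q\<^esub> a \<in> U}"
  using assms
  by (auto simp: ksubspace_iff ract_zero ract_add_left ract_closed ract_scalar \<eta>_closed)

lemma prod_generators_closed:
  "V \<subseteq> carrier Q \<Longrightarrow> S \<subseteq> carrier A \<Longrightarrow> {v \<triangleleft>\<^bsub>Q\<^esub> a | v a. v \<in> V \<and> a \<in> S} \<subseteq> carrier Q"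
  using ract_closed by blast

lemma prod_subspace: "V \<subseteq> carrier Q \<Longrightarrow> S \<subseteq> carrier A \<Longrightarrow> ksubspace (prod V S)"
  unfolding prod_space_def by (intro span_subspace prod_generators_closed)

lemma prod_closed: "V \<subseteq> carrier Q \<Longrightarrow> S \<subseteq> carrier A \<Longrightarrow> prod V S \<subseteq> carrier Q"
  using prod_subspace by (auto simp: ksubspace_iff)

lemma prodI:
  "v \<in> V \<Longrightarrow> a \<in> S \<Longrightarrow> V \<subseteq> carrier Q \<Longrightarrow> S \<subseteq> carrier A \<Longrightarrow> v \<triangleleft>\<^bsub>Q\<^esub> a \<in> prod V S"
  unfolding prod_space_def using span_superset[OF prod_generators_closed] by blast

lemma prod_least:
  "ksubspace U \<Longrightarrow> (\<And>v a. v \<in> V \<Longrightarrow> a \<in> S \<Longrightarrow> v \<triangleleft>\<^bsub>Q\<^esub> a \<in> U) \<Longrightarrow> prod V S \<subseteq> U"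
  unfolding prod_space_def by (rule span_least) auto

lemma prod_mono:
  assumes "V \<subseteq> W" "S \<subseteq> T" "W \<subseteq> carrier Q" "T \<subseteq> carrier A"
  shows "prod V S \<subseteq> prod W T"
  using assms by (intro prod_least prod_subspace prodI) auto

end

lemma right_module_regular:
  assumes "ring A"
  shows "right_module A (regular_rmodule A)"
proof -
  interpret ring A by fact
  have "abelian_group (regular_rmodule A)"
    by (rule abelian_groupI)
       (auto simp: regular_rmodule_def a_assoc intro: a_comm l_neg bexI[of _ "\<ominus>\<^bsub>A\<^esub> _"])
  thus ?thesis
    by (auto intro!: right_module.intro right_module_axioms.intro assms
        simp: regular_rmodule_def l_distr r_distr m_assoc)
qed

sublocale central_algebra \<subseteq> reg: algebra_module K \<eta> A "regular_rmodule A"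
  by (intro algebra_module.intro right_module_regular central_algebra_axioms A.ring_axioms)

context algebra_module
begin

lemma ksubspace_preimage_orbit:
  assumes "ksubspace U" "v \<in> carrier Q"
  shows "reg.ksubspace {a \<in> carrier A. v \<triangleleft>\<^bsub>Q\<^esub> a \<in> U}"
  unfolding reg.ksubspace_iff using assms
  by (auto simp: ksubspace_iff ract_zero_right ract_add_right ract_closed ract_assoc \<eta>_closed
      regular_rmodule_def)

text \<open>
  By bilinearity, it suffices to test products of spans on the spanning vectors: both preimages
  occurring above are subspaces.
\<close>

lemma ract_span_in:
  assumes U: "ksubspace U" and VS: "V \<subseteq> carrier Q" "S \<subseteq> carrier A"
    and gen: "\<And>v a. v \<in> V \<Longrightarrow> a \<in> S \<Longrightarrow> v \<triangleleft>\<^bsub>Q\<^esub> a \<in> U"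
    and v: "v \<in> span V" and a: "a \<in> reg.span S"
  shows "v \<triangleleft>\<^bsub>Q\<^esub> a \<in> U"
proof -
  have "v \<triangleleft>\<^bsub>Q\<^esub> s \<in> U" if "s \<in> S" for s
    using span_least[OF ksubspace_preimage_ract[OF U, of s], of V] v gen VS that by auto
  moreover have "v \<in> carrier Q"
    using v span_closed[OF VS(1)] by auto
  ultimately show ?thesis
    using reg.span_least[OF ksubspace_preimage_orbit[OF U, of v], of S] a VS by auto
qed

lemma finite_dim_prod:
  assumes "finite_dim_subspace K \<eta> Q V" "finite_dim_subspace K \<eta> (regular_rmodule A) S"
  shows "finite_dim_subspace K \<eta> Q (prod V S)"
proof -
  obtain B where B: "finite B" "B \<subseteq> carrier Q" "span B = V"
    using assms finite_dim_subspace_iff by auto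
  obtain C where C: "finite C" "C \<subseteq> carrier A" "reg.span C = S"
    using assms reg.finite_dim_subspace_iff by (auto simp: regular_rmodule_def)
  define D where "D = (\<lambda>(b, c). b \<triangleleft>\<^bsub>Q\<^esub> c) ` (B \<times> C)"
  have D: "finite D" "D \<subseteq> carrier Q"
    using B C ract_closed by (auto simp: D_def)
  have V: "V \<subseteq> carrier Q" "B \<subseteq> V"
    using B span_closed span_superset by blast+
  have S: "S \<subseteq> carrier A" "C \<subseteq> S"
    using C reg.span_closed[of C] reg.span_superset[of C] by (auto simp: regular_rmodule_def)
  have "prod V S \<subseteq> span D"
  proof (rule prod_least[OF span_subspace[OF D(2)]])
    fix v a assume "v \<in> V" "a \<in> S"
    thus "v \<triangleleft>\<^bsub>Q\<^esub> a \<in> span D"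
      using B C span_superset[OF D(2)]
      by (rule_tac ract_span_in[OF span_subspace[OF D(2)], of B C]) (auto simp: D_def)
  qed
  moreover have "span D \<subseteq> prod V S"
    using V S by (intro span_least prod_subspace) (auto simp: D_def intro!: prodI)
  ultimately show ?thesis
    using D finite_dim_subspace_iff by auto
qed

end

locale algebra_filtration = central_algebra K \<eta> A
  for K :: "('k, 'e) ring_scheme" and \<eta> :: "'k \<Rightarrow> 'a" and A :: "('a, 'c) ring_scheme" +
  fixes S :: "'a set"
  assumes S: "finite S" "S \<subseteq> carrier A" "\<one>\<^bsub>A\<^esub> \<in> S"
begin

abbreviation F :: "nat \<Rightarrow> 'a set" where
  "F \<equiv> alg_filtration K \<eta> A S"

lemma regular_simps:
  "carrier (regular_rmodule A) = carrier A"
  "\<zero>\<^bsub>regular_rmodule A\<^esub> = \<zero>\<^bsub>A\<^esub>"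
  "a \<oplus>\<^bsub>regular_rmodule A\<^esub> b = a \<oplus>\<^bsub>A\<^esub> b"
  "a \<triangleleft>\<^bsub>regular_rmodule A\<^esub> b = a \<otimes>\<^bsub>A\<^esub> b"
  by (auto simp: regular_rmodule_def)

lemma F_closed: "F m \<subseteq> carrier A"
proof (induction m)
  case 0
  show ?case using reg.\<eta>_closed by auto
next
  case (Suc m)
  show ?case
    using reg.prod_closed[of "F m" "reg.span S"] Suc reg.span_closed[of S] S
    by (simp add: regular_simps)
qed

lemma span_S: "S \<subseteq> reg.span S" "reg.span S \<subseteq> carrier A"
  using reg.span_superset[of S] reg.span_closed[of S] S by (auto simp: regular_simps)

lemma F_finite_dim: "finite_dim_subspace K \<eta> (regular_rmodule A) (F m)"
proof (induction m)
  case 0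
  have "reg.ksubspace (\<eta> ` carrier K)"
    unfolding reg.ksubspace_iff regular_simps
  proof (intro conjI ballI)
    show "\<zero>\<^bsub>A\<^esub> \<in> \<eta> ` carrier K"
      using ring_hom_zero[OF \<eta>_hom K.ring_axioms A.ring_axioms] by (metis K.zero_closed imageI)
  next
    fix u v assume "u \<in> \<eta> ` carrier K" "v \<in> \<eta> ` carrier K"
    thus "u \<oplus>\<^bsub>A\<^esub> v \<in> \<eta> ` carrier K"
      using ring_hom_add[OF \<eta>_hom] by (metis (no_types, lifting) K.add.m_closed imageE imageI)
  next
    fix c u assume "c \<in> carrier K" "u \<in> \<eta> ` carrier K"
    thus "u \<otimes>\<^bsub>A\<^esub> \<eta> c \<in> \<eta> ` carrier K"
      using ring_hom_mult[OF \<eta>_hom] by (metis (no_types, lifting) K.m_closed imageE imageI)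
  qed (use reg.\<eta>_closed in auto)
  moreover have "\<eta> ` carrier K \<subseteq> reg.span {\<one>\<^bsub>A\<^esub>}"
  proof
    fix a assume "a \<in> \<eta> ` carrier K"
    then obtain c where c: "c \<in> carrier K" "a = \<eta> c" by auto
    have "\<one>\<^bsub>A\<^esub> \<otimes>\<^bsub>A\<^esub> \<eta> c \<in> reg.span {\<one>\<^bsub>A\<^esub>}"
      using reg.span_subspace[of "{\<one>\<^bsub>A\<^esub>}"] reg.span_superset[of "{\<one>\<^bsub>A\<^esub>}"] c
      unfolding reg.ksubspace_iff regular_simps by auto
    with c reg.\<eta>_closed show "a \<in> reg.span {\<one>\<^bsub>A\<^esub>}" by simp
  qed
  moreover have "\<one>\<^bsub>A\<^esub> \<in> \<eta> ` carrier K"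
    using ring_hom_one[OF \<eta>_hom] by (metis K.one_closed imageI)
  ultimately have "reg.span {\<one>\<^bsub>A\<^esub>} = F 0"
    by (auto dest: reg.span_least[of _ "{\<one>\<^bsub>A\<^esub>}"])
  thus ?case
    using reg.finite_dim_subspace_iff regular_simps(1)
    by (metis A.one_closed empty_subsetI finite.emptyI finite.insertI insert_subset)
next
  case (Suc m)
  have "finite_dim_subspace K \<eta> (regular_rmodule A) (reg.span S)"
    using reg.finite_dim_subspace_iff S by (auto simp: regular_simps)
  with Suc show ?case
    by (auto intro: reg.finite_dim_prod)
qed

lemma F_subspace: "reg.ksubspace (F m)"
  using F_finite_dim by (auto simp: finite_dim_subspace_def)

lemma F_step: "a \<in> F m \<Longrightarrow> s \<in> reg.span S \<Longrightarrow> a \<otimes>\<^bsub>A\<^esub> s \<in> F (Suc m)"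
  using reg.prodI[of a "F m" s "reg.span S"] F_closed span_S by (auto simp: regular_simps)

lemma F_Suc_least:
  assumes "reg.ksubspace U" "\<And>a s. a \<in> F m \<Longrightarrow> s \<in> S \<Longrightarrow> a \<otimes>\<^bsub>A\<^esub> s \<in> U"
  shows "F (Suc m) \<subseteq> U"
  unfolding alg_filtration.simps
proof (rule reg.prod_least[OF assms(1)])
  fix a s assume a: "a \<in> F m" and s: "s \<in> reg.span S"
  show "a \<triangleleft>\<^bsub>regular_rmodule A\<^esub> s \<in> U"
    using assms a s F_closed[of m] S reg.span_superset[of "F m"]
    by (rule_tac reg.ract_span_in[OF assms(1), of "F m" S]) (auto simp: regular_simps)
qed

lemma one_in_F: "\<one>\<^bsub>A\<^esub> \<in> F m"
proof (induction m)
  case 0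
  show ?case using ring_hom_one[OF \<eta>_hom] by (metis K.one_closed imageI alg_filtration.simps(1))
next
  case (Suc m)
  with F_step[of "\<one>\<^bsub>A\<^esub>" m "\<one>\<^bsub>A\<^esub>"] S span_S show ?case by auto
qed

lemma F_mult: "a \<in> F s \<Longrightarrow> b \<in> F t \<Longrightarrow> a \<otimes>\<^bsub>A\<^esub> b \<in> F (s + t)"
proof (induction t arbitrary: b)
  case 0
  then obtain c where "c \<in> carrier K" "b = \<eta> c" by auto
  thus ?case
    using F_subspace[of s] 0 unfolding reg.ksubspace_iff regular_simps by auto
next
  case (Suc t)
  have a: "a \<in> carrier A"
    using Suc.prems F_closed by auto
  have "F (Suc t) \<subseteq> {b \<in> carrier A. a \<otimes>\<^bsub>A\<^esub> b \<in> F (s + Suc t)}"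
  proof (rule F_Suc_least)
    show "reg.ksubspace {b \<in> carrier A. a \<otimes>\<^bsub>A\<^esub> b \<in> F (s + Suc t)}"
      using reg.ksubspace_preimage_orbit[OF F_subspace, of a "s + Suc t"] a
      by (simp add: regular_simps)
    fix b s' assume b: "b \<in> F t" and s': "s' \<in> S"
    have "a \<otimes>\<^bsub>A\<^esub> (b \<otimes>\<^bsub>A\<^esub> s') = (a \<otimes>\<^bsub>A\<^esub> b) \<otimes>\<^bsub>A\<^esub> s'"
      using a b s' S F_closed by (metis A.m_assoc subsetD)
    also have "\<dots> \<in> F (s + Suc t)"
      using F_step[OF Suc.IH[OF Suc.prems(1) b], of s'] s' span_S by auto
    finally show "b \<otimes>\<^bsub>A\<^esub> s' \<in> {b \<in> carrier A. a \<otimes>\<^bsub>A\<^esub> b \<in> F (s + Suc t)}"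
      using b s' S F_closed[of t] by auto
  qed
  with Suc.prems show ?case by auto
qed

lemma F_mono: "s \<le> t \<Longrightarrow> F s \<subseteq> F t"
proof
  fix a assume "s \<le> t" "a \<in> F s"
  with F_mult[of a s "\<one>\<^bsub>A\<^esub>" "t - s"] one_in_F[of "t - s"] F_closed[of s] show "a \<in> F t"
    by auto
qed

lemma S_sub_F1: "S \<subseteq> F 1"
proof
  fix s assume s: "s \<in> S"
  hence "\<one>\<^bsub>A\<^esub> \<otimes>\<^bsub>A\<^esub> s = s"
    using S by auto
  with F_step[OF one_in_F[of 0], of s] span_S s show "s \<in> F 1"
    by (metis One_nat_def subsetD)
qed

text \<open>
  The filtration by powers is the least one that contains the scalars in degree \<open>0\<close> and in which
  the generators have degree at most \<open>1\<close>; this is how it is compared with other filtrations.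
\<close>

lemma F_least_filtration:
  assumes "\<eta> ` carrier K \<subseteq> G 0" "\<And>m. reg.ksubspace (G m)"
    and "\<And>m a s. a \<in> G m \<Longrightarrow> s \<in> S \<Longrightarrow> a \<otimes>\<^bsub>A\<^esub> s \<in> G (Suc m)"
  shows "F m \<subseteq> G m"
proof (induction m)
  case (Suc m)
  with assms show ?case by (intro F_Suc_least) auto
qed (use assms in auto)

end

locale affine_algebra = algebra_filtration +
  assumes exhausting: "(\<Union>m. alg_filtration K \<eta> A S m) = carrier A"
begin

lemma gen: "alg_generating_set K \<eta> A S"
  using S exhausting by (simp add: alg_generating_set_def)

lemma finite_sub_F: "finite B \<Longrightarrow> B \<subseteq> carrier A \<Longrightarrow> \<exists>t. B \<subseteq> F t"
proof (induction B rule: finite_induct)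
  case (insert b B)
  then obtain t where "B \<subseteq> F t" by auto
  moreover obtain s where "b \<in> F s"
    using exhausting insert.prems by blast
  ultimately have "insert b B \<subseteq> F (max s t)"
    using F_mono[of s "max s t"] F_mono[of t "max s t"] by auto
  thus ?case ..
qed auto

end

locale affine_algebra_module = affine_algebra K \<eta> A S + algebra_module K \<eta> A Q
  for K :: "('k, 'e) ring_scheme" and \<eta> :: "'k \<Rightarrow> 'a" and A :: "('a, 'c) ring_scheme"
    and S :: "'a set" and Q :: "('a, 'b) rmodule" +
  fixes V :: "'b set"
  assumes gen_Q: "generating_subspace K \<eta> A Q V"
begin

lemma V: "finite_dim_subspace K \<eta> Q V" "V \<subseteq> carrier Q"
  using gen_Q by (auto simp: generating_subspace_def finite_dim_subspace_def ksubspace_iff)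

lemma finite_dim_prod_F: "finite_dim_subspace K \<eta> Q (prod V (F m))"
  using V F_finite_dim by (intro finite_dim_prod)

lemma prod_F_mono: "s \<le> t \<Longrightarrow> prod V (F s) \<subseteq> prod V (F t)"
  using F_mono[of s t] V F_closed by (intro prod_mono) auto

lemma prod_F_mult:
  assumes "v \<in> prod V (F s)" "a \<in> F t"
  shows "v \<triangleleft>\<^bsub>Q\<^esub> a \<in> prod V (F (s + t))"
proof -
  have sub: "ksubspace (prod V (F (s + t)))"
    using V F_closed by (intro prod_subspace)
  have a: "a \<in> carrier A"
    using assms F_closed by auto
  have "prod V (F s) \<subseteq> {v \<in> carrier Q. v \<triangleleft>\<^bsub>Q\<^esub> a \<in> prod V (F (s + t))}"
  proof (rule prod_least[OF ksubspace_preimage_ract[OF sub a]])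
    fix v b assume v: "v \<in> V" and b: "b \<in> F s"
    have "v \<triangleleft>\<^bsub>Q\<^esub> (b \<otimes>\<^bsub>A\<^esub> a) \<in> prod V (F (s + t))"
      using v b assms F_mult V F_closed by (intro prodI) auto
    thus "v \<triangleleft>\<^bsub>Q\<^esub> b \<in> {v \<in> carrier Q. v \<triangleleft>\<^bsub>Q\<^esub> a \<in> prod V (F (s + t))}"
      using v b a V F_closed[of s] by (simp add: subset_iff ract_assoc ract_closed)
  qed
  with assms show ?thesis by auto
qed

lemma exhausts: "v \<in> carrier Q \<Longrightarrow> \<exists>s. v \<in> prod V (F s)"
proof -
  define U where "U = (\<Union>s. prod V (F s))"
  have sub: "ksubspace (prod V (F s))" for s
    using V F_closed by (intro prod_subspace)
  have "ksubspace U"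
    unfolding ksubspace_iff
  proof (intro conjI ballI)
    fix u v assume "u \<in> U" "v \<in> U"
    then obtain s t where "u \<in> prod V (F s)" "v \<in> prod V (F t)"
      by (auto simp: U_def)
    hence "u \<in> prod V (F (max s t))" "v \<in> prod V (F (max s t))"
      using prod_F_mono[of s "max s t"] prod_F_mono[of t "max s t"] by auto
    hence "u \<oplus>\<^bsub>Q\<^esub> v \<in> prod V (F (max s t))"
      using sub[of "max s t"] by (auto simp: ksubspace_iff)
    thus "u \<oplus>\<^bsub>Q\<^esub> v \<in> U" by (auto simp: U_def)
  qed (use sub[unfolded ksubspace_iff] in \<open>unfold U_def, blast+\<close>)
  moreover have "v \<triangleleft>\<^bsub>Q\<^esub> a \<in> U" if "v \<in> V" "a \<in> carrier A" for v a
  proof -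
    obtain s where "a \<in> F s"
      using gen \<open>a \<in> carrier A\<close> unfolding alg_generating_set_def by blast
    with that V F_closed show ?thesis
      by (auto simp: U_def intro!: exI[of _ s] prodI)
  qed
  ultimately have "prod V (carrier A) \<subseteq> U"
    by (rule prod_least)
  moreover assume "v \<in> carrier Q"
  ultimately show ?thesis
    using gen_Q by (auto simp: generating_subspace_def U_def)
qed

lemma finite_dim_sub_prod_F:
  assumes "finite_dim_subspace K \<eta> Q W"
  shows "\<exists>s. W \<subseteq> prod V (F s)"
proof -
  obtain B where B: "finite B" "B \<subseteq> carrier Q" "span B = W"
    using assms finite_dim_subspace_iff by auto
  have "\<exists>s. B \<subseteq> prod V (F s)"
    using B(1,2)
  proof (induction B rule: finite_induct)
    case (insert b B)
    then obtain s t where "B \<subseteq> prod V (F s)" "b \<in> prod V (F t)"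
      using exhausts by (metis insert_subset)
    hence "insert b B \<subseteq> prod V (F (max s t))"
      using prod_F_mono[of s "max s t"] prod_F_mono[of t "max s t"] by auto
    thus ?case ..
  qed auto
  thus ?thesis
    using B span_least prod_subspace[OF V(2) F_closed] by metis
qed

end

text \<open>
  If \<open>S \<subseteq> A'\<^sub>t\<close> and \<open>V \<subseteq> V'A'\<^sub>s\<close>, then \<open>VA\<^sub>m \<subseteq> V'A'\<^sub>t\<^sub>m\<^sub>+\<^sub>s\<close>: a change of generators reparametrises the
  growth function linearly.
\<close>

lemma gkdim_wrt_le:
  assumes "affine_algebra_module K \<eta> A S Q V" "affine_algebra_module K \<eta> A S' Q V'"
  shows "gkdim_wrt K \<eta> A Q S V \<le> gkdim_wrt K \<eta> A Q S' V'"
proof -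
  interpret G: affine_algebra_module K \<eta> A S Q V by fact
  interpret H: affine_algebra_module K \<eta> A S' Q V' by fact
  obtain s where s: "V \<subseteq> G.prod V' (H.F s)"
    using H.finite_dim_sub_prod_F[OF G.V(1)] by blast
  obtain t where t: "S \<subseteq> H.F t"
    using H.finite_sub_F[OF G.S(1,2)] by blast
  have F: "G.F m \<subseteq> H.F (t * m)" for m
  proof (rule G.F_least_filtration)
    fix m a s assume "a \<in> H.F (t * m)" "s \<in> S"
    thus "a \<otimes>\<^bsub>A\<^esub> s \<in> H.F (t * Suc m)"
      using H.F_mult[of a "t * m" s t] t by (auto simp: add.commute)
  qed (use H.F_subspace in auto)
  have "G.prod V (G.F m) \<subseteq> G.prod V' (H.F (t * m + s))" for m
  proof (rule G.prod_least[OF G.prod_subspace[OF H.V(2) H.F_closed]])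
    fix v a assume "v \<in> V" "a \<in> G.F m"
    thus "v \<triangleleft>\<^bsub>Q\<^esub> a \<in> G.prod V' (H.F (t * m + s))"
      using H.prod_F_mult[of v s a "t * m"] s F[of m] by (auto simp: add.commute)
  qed
  hence "kdim K \<eta> Q (G.prod V (G.F m)) \<le> kdim K \<eta> Q (G.prod V' (H.F (t * m + s)))" for m
    by (intro G.kdim_mono G.finite_dim_prod_F H.finite_dim_prod_F)
  moreover have "mono (\<lambda>m. kdim K \<eta> Q (G.prod V' (H.F m)))"
    by (intro monoI G.kdim_mono H.finite_dim_prod_F H.prod_F_mono)
  ultimately show ?thesis
    unfolding gkdim_wrt_def by (intro limsup_log_dim_reparam)
qed

text \<open>All choices of generators give the same value, so the choice operator in \<open>gkdim\<close> is harmless.\<close>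

lemma (in affine_algebra_module) gkdim_eq: "gkdim K \<eta> A Q = gkdim_wrt K \<eta> A Q S V"
  unfolding gkdim_def
proof (rule some_equality)
  show "\<exists>S' V'. alg_generating_set K \<eta> A S' \<and> generating_subspace K \<eta> A Q V' \<and>
      gkdim_wrt K \<eta> A Q S V = gkdim_wrt K \<eta> A Q S' V'"
    using gen gen_Q by blast
next
  fix d
  assume "\<exists>S' V'. alg_generating_set K \<eta> A S' \<and> generating_subspace K \<eta> A Q V' \<and>
      d = gkdim_wrt K \<eta> A Q S' V'"
  then obtain S' V' where d: "d = gkdim_wrt K \<eta> A Q S' V'"
    and "alg_generating_set K \<eta> A S'" "generating_subspace K \<eta> A Q V'"
    by blast
  hence "affine_algebra_module K \<eta> A S' Q V'"
    by unfold_locales (auto simp: alg_generating_set_def)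
  with affine_algebra_module_axioms show "d = gkdim_wrt K \<eta> A Q S V"
    unfolding d by (intro antisym gkdim_wrt_le)
qed

section \<open>The tensor product with a ring extension\<close>

locale ring_extension_tensor = N: right_module A N + B: ring B
  for A :: "('a, 'c) ring_scheme" and B :: "('r, 'd) ring_scheme" and N :: "('a, 'b) rmodule" +
  fixes \<phi> :: "'a \<Rightarrow> 'r"
  assumes \<phi>_hom: "\<phi> \<in> ring_hom A B"
begin

abbreviation T :: "('r, ('b \<times> 'r \<Rightarrow>\<^sub>0 int) set) rmodule" where
  "T \<equiv> tensor_rmodule A \<phi> B N"

abbreviation free where "free \<equiv> tensor_free B N"

abbreviation relations where "relations \<equiv> tensor_relations A \<phi> B N"

abbreviation kernel where "kernel \<equiv> tensor_kernel A \<phi> B N"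

definition coset :: "('b \<times> 'r \<Rightarrow>\<^sub>0 int) \<Rightarrow> ('b \<times> 'r \<Rightarrow>\<^sub>0 int) set" where
  "coset f = kernel #>\<^bsub>free\<^esub> f"

definition pure :: "'b \<Rightarrow> 'r \<Rightarrow> ('b \<times> 'r \<Rightarrow>\<^sub>0 int) set" where
  "pure v b = coset (frag_of (v, b))"

definition free_ract :: "'r \<Rightarrow> ('b \<times> 'r \<Rightarrow>\<^sub>0 int) \<Rightarrow> ('b \<times> 'r \<Rightarrow>\<^sub>0 int)" where
  "free_ract c = frag_extend (\<lambda>(v, b). frag_of (v, b \<otimes>\<^bsub>B\<^esub> c))"

lemma free_simps [simp]:
  "f \<in> carrier free \<longleftrightarrow> Poly_Mapping.keys f \<subseteq> carrier N \<times> carrier B"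
  "\<one>\<^bsub>free\<^esub> = 0" "f \<otimes>\<^bsub>free\<^esub> g = f + g"
  by (simp_all add: tensor_free_def)

lemma free_comm_group: "comm_group free"
  unfolding tensor_free_def by (rule abelian_free_Abelian_group)

sublocale free: comm_group free
  by (rule free_comm_group)

lemma free_inv: "f \<in> carrier free \<Longrightarrow> inv\<^bsub>free\<^esub> f = - f"
  by (simp add: tensor_free_def)

lemma free_diff: "f \<in> carrier free \<Longrightarrow> g \<in> carrier free \<Longrightarrow> f - g \<in> carrier free"
  using keys_diff[of f g] by auto

lemma relations_closed: "relations \<subseteq> carrier free"
proof -
  have "frag_of (v, b) \<in> carrier free" if "v \<in> carrier N" "b \<in> carrier B" for v b
    using that by simp
  thus ?thesis
    unfolding tensor_relations_def
    using N.ract_closed ring_hom_closed[OF \<phi>_hom]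
    by (auto simp del: free_simps intro!: free_diff)
qed

lemma kernel_subgroup: "subgroup kernel free"
  unfolding tensor_kernel_def by (rule free.generate_is_subgroup[OF relations_closed])

lemma kernel_least: "subgroup Y free \<Longrightarrow> relations \<subseteq> Y \<Longrightarrow> kernel \<subseteq> Y"
  unfolding tensor_kernel_def by (rule free.generate_subgroup_incl)

lemma relations_in_kernel: "relations \<subseteq> kernel"
  unfolding tensor_kernel_def by (auto intro: generate.incl)

lemma kernel_closed: "kernel \<subseteq> carrier free"
  using kernel_subgroup by (rule subgroup.subset)

lemma kernel_group:
  "0 \<in> kernel" "f \<in> kernel \<Longrightarrow> g \<in> kernel \<Longrightarrow> f + g \<in> kernel"
  "f \<in> kernel \<Longrightarrow> - f \<in> kernel"
  using subgroup.one_closed[OF kernel_subgroup] subgroup.m_closed[OF kernel_subgroup]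
    subgroup.m_inv_closed[OF kernel_subgroup, of f] free_inv[of f] kernel_closed by auto

lemma coset_image: "coset f = (\<lambda>h. h + f) ` kernel"
  by (auto simp: coset_def r_coset_def)

lemma coset_eq_iff: "coset f = coset g \<longleftrightarrow> f - g \<in> kernel"
proof
  assume "coset f = coset g"
  moreover have "f \<in> coset f"
    using kernel_group(1) by (force simp: coset_image)
  ultimately show "f - g \<in> kernel"
    by (auto simp: coset_image)
next
  assume fg: "f - g \<in> kernel"
  have "coset f \<subseteq> coset g" if "f - g \<in> kernel" for f g
  proof
    fix x assume "x \<in> coset f"
    then obtain h where "h \<in> kernel" "x = h + f" by (auto simp: coset_image)
    hence "h + (f - g) \<in> kernel" "x = (h + (f - g)) + g"
      using kernel_group(2) that by auto
    thus "x \<in> coset g" unfolding coset_image by blast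
  qed
  from this[OF fg] this[of g f] kernel_group(3)[OF fg] show "coset f = coset g" by auto
qed

lemma carrier_T: "carrier T = coset ` carrier free"
  by (auto simp: tensor_rmodule_def Let_def FactGroup_def RCOSETS_def coset_def)

lemma coset_closed: "f \<in> carrier free \<Longrightarrow> coset f \<in> carrier T"
  by (simp add: carrier_T)

lemma kernel_normal: "kernel \<lhd> free"
  using kernel_subgroup free.normal_iff_subgroup by blast

lemma coset_add:
  "f \<in> carrier free \<Longrightarrow> g \<in> carrier free \<Longrightarrow> coset f \<oplus>\<^bsub>T\<^esub> coset g = coset (f + g)"
  using normal.rcos_sum[OF kernel_normal, of f g]
  by (simp add: tensor_rmodule_def Let_def FactGroup_def coset_def)

lemma coset_zero: "coset 0 = \<zero>\<^bsub>T\<^esub>"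
  by (simp add: coset_image tensor_rmodule_def Let_def FactGroup_def)

lemma abelian_group_T: "abelian_group T"
proof -
  interpret quot: comm_group "free Mod kernel"
    by (rule free.abelian_FactGroup[OF kernel_subgroup])
  have T: "carrier T = carrier (free Mod kernel)" "\<zero>\<^bsub>T\<^esub> = \<one>\<^bsub>free Mod kernel\<^esub>"
    "x \<oplus>\<^bsub>T\<^esub> y = x \<otimes>\<^bsub>free Mod kernel\<^esub> y" for x y
    by (simp_all add: tensor_rmodule_def Let_def)
  show ?thesis
    by (rule abelian_groupI, unfold T)
       (simp_all only: quot.m_closed quot.one_closed quot.m_assoc quot.l_one quot.l_inv_ex,
        simp only: quot.m_comm)
qed

sublocale T: abelian_group T
  by (rule abelian_group_T)

lemma pure_closed: "v \<in> carrier N \<Longrightarrow> b \<in> carrier B \<Longrightarrow> pure v b \<in> carrier T"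
  unfolding pure_def by (rule coset_closed) simp

lemma pure_add_left:
  assumes "u \<in> carrier N" "v \<in> carrier N" "b \<in> carrier B"
  shows "pure (u \<oplus>\<^bsub>N\<^esub> v) b = pure u b \<oplus>\<^bsub>T\<^esub> pure v b"
proof -
  have "frag_of (u \<oplus>\<^bsub>N\<^esub> v, b) - frag_of (u, b) - frag_of (v, b) \<in> kernel"
    using relations_in_kernel assms by (auto simp: tensor_relations_def)
  thus ?thesis
    using assms by (simp add: pure_def coset_add coset_eq_iff algebra_simps)
qed

lemma pure_add_right:
  assumes "v \<in> carrier N" "b \<in> carrier B" "c \<in> carrier B"
  shows "pure v (b \<oplus>\<^bsub>B\<^esub> c) = pure v b \<oplus>\<^bsub>T\<^esub> pure v c"
proof -
  have "frag_of (v, b \<oplus>\<^bsub>B\<^esub> c) - frag_of (v, b) - frag_of (v, c) \<in> kernel"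
    using relations_in_kernel assms unfolding tensor_relations_def by blast
  thus ?thesis
    using assms by (simp add: pure_def coset_add coset_eq_iff algebra_simps)
qed

lemma pure_balanced:
  assumes "v \<in> carrier N" "a \<in> carrier A" "b \<in> carrier B"
  shows "pure (v \<triangleleft>\<^bsub>N\<^esub> a) b = pure v (\<phi> a \<otimes>\<^bsub>B\<^esub> b)"
proof -
  have "frag_of (v \<triangleleft>\<^bsub>N\<^esub> a, b) - frag_of (v, \<phi> a \<otimes>\<^bsub>B\<^esub> b) \<in> kernel"
    using relations_in_kernel assms unfolding tensor_relations_def by blast
  thus ?thesis
    by (simp add: pure_def coset_eq_iff)
qed

lemma pure_zero_right: "v \<in> carrier N \<Longrightarrow> pure v \<zero>\<^bsub>B\<^esub> = \<zero>\<^bsub>T\<^esub>"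
  using pure_add_right[of v "\<zero>\<^bsub>B\<^esub>" "\<zero>\<^bsub>B\<^esub>"] pure_closed[of v "\<zero>\<^bsub>B\<^esub>"]
  by (simp add: T.add.l_cancel_one')

lemma pure_zero_left: "b \<in> carrier B \<Longrightarrow> pure \<zero>\<^bsub>N\<^esub> b = \<zero>\<^bsub>T\<^esub>"
  using pure_add_left[of "\<zero>\<^bsub>N\<^esub>" "\<zero>\<^bsub>N\<^esub>" b] pure_closed[of "\<zero>\<^bsub>N\<^esub>" b]
  by (simp add: T.add.l_cancel_one')

text \<open>
  Every element is a sum of pure tensors, without signs, because \<open>- (v \<otimes> b) = (- v) \<otimes> b\<close>.
\<close>

lemma tensor_induct [consumes 1, case_names zero pure add]:
  assumes t: "t \<in> carrier T"
    and zero: "P \<zero>\<^bsub>T\<^esub>"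
    and pure: "\<And>v b. v \<in> carrier N \<Longrightarrow> b \<in> carrier B \<Longrightarrow> P (pure v b)"
    and add: "\<And>s t. \<lbrakk>s \<in> carrier T; t \<in> carrier T; P s; P t\<rbrakk> \<Longrightarrow> P (s \<oplus>\<^bsub>T\<^esub> t)"
  shows "P t"
proof -
  have neg: "coset (- frag_of (v, b)) = pure (\<ominus>\<^bsub>N\<^esub> v) b" if "v \<in> carrier N" "b \<in> carrier B" for v b
  proof -
    have "pure (\<ominus>\<^bsub>N\<^esub> v) b \<oplus>\<^bsub>T\<^esub> pure v b = \<zero>\<^bsub>T\<^esub>"
      using that by (simp add: pure_add_left[symmetric] N.Q.l_neg pure_zero_left)
    moreover have "coset (- frag_of (v, b)) \<oplus>\<^bsub>T\<^esub> pure v b = \<zero>\<^bsub>T\<^esub>"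
      unfolding pure_def using that by (subst coset_add) (auto simp: coset_zero)
    moreover have "coset (- frag_of (v, b)) \<in> carrier T"
      using that by (intro coset_closed) simp
    ultimately show ?thesis
      using that pure_closed by (metis T.add.inv_equality N.Q.a_inv_closed)
  qed
  have "P (coset f) \<and> P (coset (- f))" if "Poly_Mapping.keys f \<subseteq> carrier N \<times> carrier B" for f
    using that
  proof (induction f rule: free_Abelian_group_induct[consumes 1])
    case 1
    show ?case using zero by (simp add: coset_zero)
  next
    case (2 f g)
    have "coset (f - g) = coset f \<oplus>\<^bsub>T\<^esub> coset (- g)" "coset (- (f - g)) = coset (- f) \<oplus>\<^bsub>T\<^esub> coset g"
      using 2 by (simp_all add: coset_add)
    with 2 show ?case
      using add coset_closed by simp
  next
    case (3 x)
    then obtain v b where "x = (v, b)" "v \<in> carrier N" "b \<in> carrier B" by auto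
    thus ?case
      using pure neg by (simp add: pure_def[symmetric])
  qed
  with t show ?thesis
    by (auto simp: carrier_T)
qed

lemma free_ract_closed:
  assumes "f \<in> carrier free" "c \<in> carrier B"
  shows "free_ract c f \<in> carrier free"
  using assms keys_frag_extend[of "\<lambda>(v, b). frag_of (v, b \<otimes>\<^bsub>B\<^esub> c)" f]
  unfolding free_ract_def by fastforce

text \<open>Each defining relation is mapped to a relation of the same kind.\<close>

lemma free_ract_kernel:
  assumes c: "c \<in> carrier B" and h: "h \<in> kernel"
  shows "free_ract c h \<in> kernel"
proof -
  let ?X = "{f \<in> carrier free. free_ract c f \<in> kernel}"
  have "subgroup ?X free"
  proof (rule free.subgroupI)
    show "?X \<noteq> {}"
      using kernel_group(1) by (auto intro!: exI[of _ 0] simp: free_ract_def)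
    fix f g assume "f \<in> ?X" "g \<in> ?X"
    thus "inv\<^bsub>free\<^esub> f \<in> ?X" "f \<otimes>\<^bsub>free\<^esub> g \<in> ?X"
      using kernel_group free.m_closed[of f g]
      by (auto simp: free_inv free_ract_def frag_extend_minus frag_extend_add)
  qed auto
  moreover have "relations \<subseteq> ?X"
  proof
    fix r assume r: "r \<in> relations"
    hence "free_ract c r \<in> relations"
      using c ring_hom_closed[OF \<phi>_hom] N.ract_closed unfolding tensor_relations_def
      by (elim UnE CollectE exE conjE)
         (simp_all add: free_ract_def frag_extend_diff B.l_distr B.m_assoc, blast+)
    thus "r \<in> ?X"
      using r relations_closed relations_in_kernel by blast
  qed
  ultimately have "kernel \<subseteq> ?X" by (rule kernel_least)
  with h show ?thesis by auto
qed

lemma coset_ract: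
  assumes "f \<in> carrier free" "c \<in> carrier B"
  shows "coset f \<triangleleft>\<^bsub>T\<^esub> c = coset (free_ract c f)"
proof -
  have add: "free_ract c (x + y) = free_ract c x + free_ract c y" for x y
    by (simp add: free_ract_def frag_extend_add)
  have "coset f \<triangleleft>\<^bsub>T\<^esub> c = kernel <#>\<^bsub>free\<^esub> (free_ract c ` coset f)"
    by (simp add: tensor_rmodule_def Let_def free_ract_def)
  also have "\<dots> = coset (free_ract c f)"
  proof
    show "kernel <#>\<^bsub>free\<^esub> (free_ract c ` coset f) \<subseteq> coset (free_ract c f)"
    proof
      fix x assume "x \<in> kernel <#>\<^bsub>free\<^esub> (free_ract c ` coset f)"
      then obtain h h' where "h \<in> kernel" "h' \<in> kernel" "x = h + free_ract c (h' + f)"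
        by (auto simp: set_mult_def coset_image)
      hence "x = (h + free_ract c h') + free_ract c f" "h + free_ract c h' \<in> kernel"
        using kernel_group(2) free_ract_kernel[OF assms(2)] by (auto simp: add)
      thus "x \<in> coset (free_ract c f)" unfolding coset_image by blast
    qed
    show "coset (free_ract c f) \<subseteq> kernel <#>\<^bsub>free\<^esub> (free_ract c ` coset f)"
      using kernel_group(1) unfolding set_mult_def coset_image by force
  qed
  finally show ?thesis .
qed

lemma pure_ract:
  "v \<in> carrier N \<Longrightarrow> b \<in> carrier B \<Longrightarrow> c \<in> carrier B \<Longrightarrow> pure v b \<triangleleft>\<^bsub>T\<^esub> c = pure v (b \<otimes>\<^bsub>B\<^esub> c)"
  unfolding pure_def by (subst coset_ract) (auto simp: free_ract_def)

theorem right_module_T: "right_module B T"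
proof (intro right_module.intro right_module_axioms.intro B.ring_axioms abelian_group_T)
  show closed: "t \<triangleleft>\<^bsub>T\<^esub> c \<in> carrier T" if "t \<in> carrier T" "c \<in> carrier B" for t c
    using that coset_ract free_ract_closed coset_closed by (auto simp: carrier_T)
  show ract_add: "(s \<oplus>\<^bsub>T\<^esub> t) \<triangleleft>\<^bsub>T\<^esub> c = s \<triangleleft>\<^bsub>T\<^esub> c \<oplus>\<^bsub>T\<^esub> t \<triangleleft>\<^bsub>T\<^esub> c"
    if "s \<in> carrier T" "t \<in> carrier T" "c \<in> carrier B" for s t c
  proof -
    from that(1,2) have "s \<in> coset ` carrier free" "t \<in> coset ` carrier free"
      by (simp_all add: carrier_T)
    then obtain f g where "s = coset f" "t = coset g" "f \<in> carrier free" "g \<in> carrier free"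
      by blast
    with that free.m_closed[of f g] free_ract_closed[of _ c] show ?thesis
      by (simp only: coset_add coset_ract free_simps(3))
         (simp add: coset_add coset_ract free_ract_def frag_extend_add)
  qed
  have zero: "\<zero>\<^bsub>T\<^esub> \<triangleleft>\<^bsub>T\<^esub> c = \<zero>\<^bsub>T\<^esub>" if "c \<in> carrier B" for c
    using coset_ract[of 0 c] that by (simp add: coset_zero free_ract_def)
  show "t \<triangleleft>\<^bsub>T\<^esub> (b \<oplus>\<^bsub>B\<^esub> c) = t \<triangleleft>\<^bsub>T\<^esub> b \<oplus>\<^bsub>T\<^esub> t \<triangleleft>\<^bsub>T\<^esub> c"
    if "t \<in> carrier T" and bc: "b \<in> carrier B" "c \<in> carrier B" for t b c
    using that(1)
  proof (induction t rule: tensor_induct)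
    case (pure v x)
    with bc show ?case
      by (simp add: pure_ract B.r_distr pure_add_right)
  next
    case (add s t)
    with bc closed show ?case
      by (simp add: ract_add T.add.m_ac)
  qed (use bc zero in auto)
  show "t \<triangleleft>\<^bsub>T\<^esub> (b \<otimes>\<^bsub>B\<^esub> c) = t \<triangleleft>\<^bsub>T\<^esub> b \<triangleleft>\<^bsub>T\<^esub> c"
    if "t \<in> carrier T" and bc: "b \<in> carrier B" "c \<in> carrier B" for t b c
    using that(1)
  proof (induction t rule: tensor_induct)
    case (pure v x)
    with bc show ?case
      by (simp add: pure_ract B.m_assoc)
  next
    case (add s t)
    with bc closed show ?case
      by (simp add: ract_add)
  qed (use bc zero in auto)
  show "t \<triangleleft>\<^bsub>T\<^esub> \<one>\<^bsub>B\<^esub> = t" if "t \<in> carrier T" for t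
    using that
  proof (induction t rule: tensor_induct)
    case (pure v x)
    thus ?case by (simp add: pure_ract)
  next
    case (add s t)
    thus ?case by (simp add: ract_add)
  qed (use zero in auto)
qed

text \<open>
  The additive extension of \<open>f\<close> to the free abelian group kills the relations, hence factors through
  the quotient.
\<close>

theorem tensor_universal:
  assumes G: "abelian_group G"
    and closed: "\<And>v b. v \<in> carrier N \<Longrightarrow> b \<in> carrier B \<Longrightarrow> f v b \<in> carrier G"
    and add_left: "\<And>u v b. \<lbrakk>u \<in> carrier N; v \<in> carrier N; b \<in> carrier B\<rbrakk> \<Longrightarrow>
        f (u \<oplus>\<^bsub>N\<^esub> v) b = f u b \<oplus>\<^bsub>G\<^esub> f v b"
    and add_right: "\<And>v b c. \<lbrakk>v \<in> carrier N; b \<in> carrier B; c \<in> carrier B\<rbrakk> \<Longrightarrow>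
        f v (b \<oplus>\<^bsub>B\<^esub> c) = f v b \<oplus>\<^bsub>G\<^esub> f v c"
    and balanced: "\<And>v a b. \<lbrakk>v \<in> carrier N; a \<in> carrier A; b \<in> carrier B\<rbrakk> \<Longrightarrow>
        f (v \<triangleleft>\<^bsub>N\<^esub> a) b = f v (\<phi> a \<otimes>\<^bsub>B\<^esub> b)"
  obtains g where "g \<in> carrier T \<rightarrow> carrier G"
    "\<And>s t. s \<in> carrier T \<Longrightarrow> t \<in> carrier T \<Longrightarrow> g (s \<oplus>\<^bsub>T\<^esub> t) = g s \<oplus>\<^bsub>G\<^esub> g t"
    "\<And>v b. v \<in> carrier N \<Longrightarrow> b \<in> carrier B \<Longrightarrow> g (pure v b) = f v b"
proof -
  interpret G: abelian_group G by fact
  have "(\<lambda>(v, b). f v b) ` (carrier N \<times> carrier B) \<subseteq> carrier (add_monoid G)"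
    using closed by auto
  then obtain h where h: "h \<in> hom free (add_monoid G)"
    and h_of: "\<And>x. x \<in> carrier N \<times> carrier B \<Longrightarrow> h (frag_of x) = (\<lambda>(v, b). f v b) x"
    using comm_group.free_Abelian_group_universal[OF G.a_comm_group]
    unfolding tensor_free_def by metis
  interpret h: group_hom free "add_monoid G" h
    by (intro group_hom.intro group_hom_axioms.intro h free.is_group G.a_group)
  have h_closed: "h x \<in> carrier G" if "x \<in> carrier free" for x
    using h.hom_closed[OF that] by simp
  have h_diff: "h (x - y) = h x \<ominus>\<^bsub>G\<^esub> h y" if "x \<in> carrier free" "y \<in> carrier free" for x y
    using h.hom_mult[OF that(1) free.inv_closed[OF that(2)]] h.hom_inv[OF that(2)] that
    by (simp add: free_inv G.minus_eq a_inv_def)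
  have of_closed: "frag_of (v, b) \<in> carrier free" if "v \<in> carrier N" "b \<in> carrier B" for v b
    using that by simp
  have cancel: "x \<oplus>\<^bsub>G\<^esub> y \<ominus>\<^bsub>G\<^esub> x \<ominus>\<^bsub>G\<^esub> y = \<zero>\<^bsub>G\<^esub>"
    if "x \<in> carrier G" "y \<in> carrier G" for x y
  proof -
    have "x \<oplus>\<^bsub>G\<^esub> y \<ominus>\<^bsub>G\<^esub> x \<ominus>\<^bsub>G\<^esub> y =
        (x \<oplus>\<^bsub>G\<^esub> \<ominus>\<^bsub>G\<^esub> x) \<oplus>\<^bsub>G\<^esub> (y \<oplus>\<^bsub>G\<^esub> \<ominus>\<^bsub>G\<^esub> y)"
      using that by (simp only: G.minus_eq G.a_ac G.a_inv_closed G.a_closed)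
    thus ?thesis
      using that by (simp add: G.r_neg)
  qed
  have "relations \<subseteq> Coset.kernel free (add_monoid G) h"
    unfolding tensor_relations_def Coset.kernel_def
    using closed add_left add_right balanced ring_hom_closed[OF \<phi>_hom] N.ract_closed
    by (auto simp: h_diff h_of free_diff of_closed cancel G.minus_eq[of "f _ _" "f _ _"] G.r_neg
        simp del: free_simps)
  hence "kernel \<subseteq> Coset.kernel free (add_monoid G) h"
    by (intro kernel_least h.subgroup_kernel)
  then obtain g where g: "g \<in> hom (free Mod kernel) (add_monoid G)"
    and g_of: "\<And>x. x \<in> carrier free \<Longrightarrow> g (kernel #>\<^bsub>free\<^esub> x) = h x"
    using h.FactGroup_universal_kernel[OF kernel_normal] by metis
  show thesis
  proof
    show "g \<in> carrier T \<rightarrow> carrier G"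
      using g by (auto simp: hom_def tensor_rmodule_def Let_def)
    show "g (s \<oplus>\<^bsub>T\<^esub> t) = g s \<oplus>\<^bsub>G\<^esub> g t" if "s \<in> carrier T" "t \<in> carrier T" for s t
      using g that by (auto simp: hom_def tensor_rmodule_def Let_def)
    show "g (pure v b) = f v b" if "v \<in> carrier N" "b \<in> carrier B" for v b
      using g_of[OF of_closed[OF that]] h_of that by (simp add: pure_def coset_def)
  qed
qed

end

section \<open>Ore extensions by a derivation\<close>

lemma ring_of_type_algebra_simps [simp]:
  "carrier ring_of_type_algebra = UNIV"
  "a \<otimes>\<^bsub>ring_of_type_algebra\<^esub> b = a * b" "a \<oplus>\<^bsub>ring_of_type_algebra\<^esub> b = a + b"
  "\<one>\<^bsub>ring_of_type_algebra\<^esub> = 1" "\<zero>\<^bsub>ring_of_type_algebra\<^esub> = 0"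
  by (simp_all add: ring_of_type_algebra_def)

lemma ore_extension_simps [simp]:
  "carrier (ore_extension \<delta>) = UNIV"
  "p \<otimes>\<^bsub>ore_extension \<delta>\<^esub> q = ore_mult \<delta> p q" "p \<oplus>\<^bsub>ore_extension \<delta>\<^esub> q = p + q"
  "\<one>\<^bsub>ore_extension \<delta>\<^esub> = 1" "\<zero>\<^bsub>ore_extension \<delta>\<^esub> = 0"
  by (simp_all add: ore_extension_def)

lemma ore_mult_conv_sum:
  assumes "Polynomial.degree p \<le> n"
  shows "ore_mult \<delta> p q =
    (\<Sum>i\<le>n. Polynomial.smult (Polynomial.coeff p i) ((ore_lmult_x \<delta> ^^ i) q))"
  unfolding ore_mult_def using assms
  by (intro sum.mono_neutral_left) (auto simp: Polynomial.coeff_eq_0)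

lemma ore_mult_const [simp]: "ore_mult \<delta> [:a:] q = Polynomial.smult a q"
  by (simp add: ore_mult_def)

lemma ore_mult_linear:
  "ore_mult \<delta> [:b, a:] q = Polynomial.smult b q + Polynomial.smult a (ore_lmult_x \<delta> q)"
  by (subst ore_mult_conv_sum[of _ 1]) auto

lemma ore_mult_one [simp]: "ore_mult \<delta> 1 q = q"
  using ore_mult_const[of \<delta> 1 q] by (simp add: one_pCons del: ore_mult_const)

lemma ore_const_simps [simp]:
  "ore_const (a + b) = ore_const a + ore_const b" "ore_const 1 = 1" "ore_const 0 = 0"
  "ore_const (a * b) = ore_mult \<delta> (ore_const a) (ore_const b)"
  "Polynomial.coeff (ore_const a) 0 = a" "i > 0 \<Longrightarrow> Polynomial.coeff (ore_const a) i = 0"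
  by (auto simp: ore_const_def one_pCons coeff_pCons split: nat.splits)

text \<open>
  That \<open>\<delta>\<close> is a derivation is a consequence of the ring axioms of \<open>A[x,\<delta>]\<close>: distributivity of
  \<open>x(a + b)\<close> and associativity of \<open>xab\<close>.
\<close>

locale ore_derivation =
  fixes \<eta> :: "'k::field \<Rightarrow> 'a::comm_ring_1" and \<delta> :: "'a \<Rightarrow> 'a"
  assumes \<eta>: "\<eta> \<in> ring_hom ring_of_type_algebra ring_of_type_algebra"
    and \<delta>_\<eta> [simp]: "\<delta> (\<eta> c) = 0"
    and ore_ring: "ring (ore_extension \<delta>)"
begin

abbreviation k :: "'k ring" where "k \<equiv> ring_of_type_algebra"
abbreviation A :: "'a ring" where "A \<equiv> ring_of_type_algebra"
abbreviation R :: "'a Polynomial.poly ring" where "R \<equiv> ore_extension \<delta>"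
abbreviation \<xi> :: "'a Polynomial.poly" where "\<xi> \<equiv> [:0, 1:]"

sublocale R: ring R
  by (rule ore_ring)

lemma \<eta>_simps [simp]:
  "\<eta> (a + b) = \<eta> a + \<eta> b" "\<eta> (a * b) = \<eta> a * \<eta> b" "\<eta> 1 = 1"
  using ring_hom_add[OF \<eta>, of a b] ring_hom_mult[OF \<eta>, of a b] ring_hom_one[OF \<eta>] by simp_all

lemma \<eta>_zero [simp]: "\<eta> 0 = 0"
  using \<eta>_simps(1)[of 0 0] by simp

lemma \<delta>_zero [simp]: "\<delta> 0 = 0"
  using \<delta>_\<eta>[of 0] by simp

lemma \<delta>_one [simp]: "\<delta> 1 = 0"
  using \<delta>_\<eta>[of 1] by simp

lemma coeff_ore_lmult_x:
  "Polynomial.coeff (ore_lmult_x \<delta> q) j =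
     (if j = 0 then 0 else Polynomial.coeff q (j - 1)) + \<delta> (Polynomial.coeff q j)"
  by (simp add: ore_lmult_x_def coeff_map_poly coeff_pCons split: nat.splits)

lemma ore_mult_X: "ore_mult \<delta> \<xi> q = ore_lmult_x \<delta> q"
  by (simp add: ore_mult_linear)

lemma \<delta>_add: "\<delta> (a + b) = \<delta> a + \<delta> b"
proof -
  have "ore_lmult_x \<delta> ([:a:] + [:b:]) = ore_lmult_x \<delta> [:a:] + ore_lmult_x \<delta> [:b:]"
    using R.r_distr[of "[:a:]" "[:b:]" \<xi>] by (simp add: ore_mult_X)
  from arg_cong[OF this, of "\<lambda>p. Polynomial.coeff p 0"] show ?thesis
    by (simp add: coeff_ore_lmult_x del: add_pCons)
qed

lemma \<delta>_mult: "\<delta> (a * b) = \<delta> a * b + a * \<delta> b"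
proof -
  have "ore_lmult_x \<delta> [:a:] = [:\<delta> a, a:]"
    by (rule poly_eqI) (auto simp: coeff_ore_lmult_x coeff_pCons split: nat.splits)
  moreover have "ore_mult \<delta> (ore_lmult_x \<delta> [:a:]) [:b:] = ore_lmult_x \<delta> (ore_mult \<delta> [:a:] [:b:])"
    using R.m_assoc[of \<xi> "[:a:]" "[:b:]"] by (simp add: ore_mult_X)
  ultimately have "Polynomial.smult (\<delta> a) [:b:] + Polynomial.smult a (ore_lmult_x \<delta> [:b:]) =
      ore_lmult_x \<delta> [:a * b:]"
    by (simp add: ore_mult_linear)
  from arg_cong[OF this, of "\<lambda>p. Polynomial.coeff p 0"] show ?thesis
    by (simp add: coeff_ore_lmult_x)
qed

lemma lmult_x_monom: "ore_lmult_x \<delta> (Polynomial.monom (\<eta> c) i) = Polynomial.monom (\<eta> c) (Suc i)"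
  by (rule poly_eqI) (auto simp: coeff_ore_lmult_x)

lemma smult_sum_right: "Polynomial.smult a (sum f I) = (\<Sum>i\<in>I. Polynomial.smult a (f i))"
  for a :: "'b::comm_ring_1"
  by (induction I rule: infinite_finite_induct) (simp_all add: smult_add_right)

text \<open>Scalars commute with \<open>x\<close> because \<open>\<delta>\<close> vanishes on them.\<close>

lemma ore_mult_scalar: "ore_mult \<delta> p (ore_const (\<eta> c)) = Polynomial.smult (\<eta> c) p"
proof -
  have "(ore_lmult_x \<delta> ^^ i) (ore_const (\<eta> c)) = Polynomial.monom (\<eta> c) i" for i
    by (induction i) (simp_all add: ore_const_def lmult_x_monom monom_0)
  hence "ore_mult \<delta> p (ore_const (\<eta> c)) =
      (\<Sum>i\<le>Polynomial.degree p. Polynomial.monom (Polynomial.coeff p i * \<eta> c) i)"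
    by (simp add: ore_mult_def smult_monom)
  also have "\<dots> = Polynomial.smult (\<eta> c) (\<Sum>i\<le>Polynomial.degree p. Polynomial.monom (Polynomial.coeff p i) i)"
    by (simp add: smult_sum_right smult_monom mult.commute)
  finally show ?thesis
    by (simp add: poly_as_sum_of_monoms)
qed

sublocale kA: central_algebra k \<eta> A
proof (intro central_algebra.intro central_algebra_axioms.intro)
  show "ring A" "field k"
    by (rule ring_from_type_algebra field_from_type_algebra)+
qed (auto simp: \<eta> mult.commute)

abbreviation \<eta>\<^sub>R :: "'k \<Rightarrow> 'a Polynomial.poly" where
  "\<eta>\<^sub>R \<equiv> \<lambda>c. ore_const (\<eta> c)"

sublocale kR: central_algebra k \<eta>\<^sub>R R
proof (intro central_algebra.intro central_algebra_axioms.intro)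
  show "ring R" "field k"
    by (rule ore_ring field_from_type_algebra)+
  show "\<eta>\<^sub>R \<in> ring_hom k R"
    by (rule ring_hom_memI) (simp_all add: ore_const_simps(4)[of _ _ \<delta>] del: ore_mult_const)
  show "\<eta>\<^sub>R c \<otimes>\<^bsub>R\<^esub> p = p \<otimes>\<^bsub>R\<^esub> \<eta>\<^sub>R c" for c p
    by (simp add: ore_mult_scalar) (simp add: ore_const_def)
qed

lemma ore_const_hom: "ore_const \<in> ring_hom A R"
  by (rule ring_hom_memI) (simp_all add: ore_const_simps(4)[of _ _ \<delta>] del: ore_mult_const)

end

locale ore_affine = ore_derivation \<eta> \<delta> + A: affine_algebra "ring_of_type_algebra" \<eta> "ring_of_type_algebra" S
  for \<eta> :: "'k::field \<Rightarrow> 'a::comm_ring_1" and \<delta> :: "'a \<Rightarrow> 'a" and S :: "'a set"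
begin

definition S\<^sub>R :: "'a Polynomial.poly set" where
  "S\<^sub>R = insert \<xi> (ore_const ` S)"

sublocale R0: algebra_filtration k \<eta>\<^sub>R R S\<^sub>R
proof unfold_locales
  show "finite S\<^sub>R" using A.S by (simp add: S\<^sub>R_def)
  show "\<one>\<^bsub>R\<^esub> \<in> S\<^sub>R" using A.S by (force simp: S\<^sub>R_def)
qed auto

abbreviation E :: "nat \<Rightarrow> 'a Polynomial.poly set" where
  "E \<equiv> alg_filtration k \<eta>\<^sub>R R S\<^sub>R"

lemma F_sub: "a \<in> A.F m \<Longrightarrow> b \<in> A.F m \<Longrightarrow> a + b \<in> A.F m"
  "0 \<in> A.F m" "a \<in> A.F m \<Longrightarrow> a * \<eta> c \<in> A.F m"
  using A.F_subspace[of m] unfolding kA.reg.ksubspace_iff A.regular_simps by auto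

lemma E_sub: "p \<in> E m \<Longrightarrow> q \<in> E m \<Longrightarrow> p + q \<in> E m"
  "0 \<in> E m" "p \<in> E m \<Longrightarrow> Polynomial.smult (\<eta> c) p \<in> E m"
  using R0.F_subspace[of m] unfolding kR.reg.ksubspace_iff R0.regular_simps
  by (auto simp: ore_mult_scalar)

lemma sum_in_E: "(\<And>i. i \<in> I \<Longrightarrow> f i \<in> E m) \<Longrightarrow> sum f I \<in> E m"
  by (induction I rule: infinite_finite_induct) (auto intro: E_sub)

lemma F_mult': "a \<in> A.F s \<Longrightarrow> b \<in> A.F t \<Longrightarrow> a * b \<in> A.F (s + t)"
  using A.F_mult[of a s b t] by simp

lemma ore_const_in_E: "a \<in> A.F m \<Longrightarrow> ore_const a \<in> E m"
proof -
  have "A.F m \<subseteq> {a. ore_const a \<in> E m}"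
  proof (rule A.F_least_filtration)
    show "\<eta> ` carrier k \<subseteq> {a. ore_const a \<in> E 0}" by auto
    show "kA.reg.ksubspace {a. ore_const a \<in> E m}" for m
      unfolding kA.reg.ksubspace_iff A.regular_simps using E_sub
      by (auto simp: ore_const_simps(4)[of _ _ \<delta>] ore_mult_scalar simp del: ore_mult_const)
    fix m a s assume "a \<in> {a. ore_const a \<in> E m}" "s \<in> S"
    moreover have "ore_const s \<in> E 1"
      using \<open>s \<in> S\<close> R0.S_sub_F1 by (auto simp: S\<^sub>R_def)
    ultimately show "a \<otimes>\<^bsub>A\<^esub> s \<in> {a. ore_const a \<in> E (Suc m)}"
      using R0.F_mult[of "ore_const a" m "ore_const s" 1] by (simp add: ore_const_simps(4)[of _ _ \<delta>] del: ore_mult_const)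
  qed
  thus "a \<in> A.F m \<Longrightarrow> ore_const a \<in> E m" by auto
qed

lemma monom_in_E:
  assumes "a \<in> A.F m"
  shows "Polynomial.monom a j \<in> E (m + j)"
proof -
  have "Polynomial.monom 1 j \<in> E j"
  proof (induction j)
    case 0
    show ?case using R0.one_in_F[of 0] by (simp add: monom_0 one_pCons)
  next
    case (Suc j)
    have "\<xi> \<in> E 1" using R0.S_sub_F1 by (auto simp: S\<^sub>R_def)
    from R0.F_mult[OF this Suc] lmult_x_monom[of 1 j] show ?case
      by (simp add: ore_mult_X)
  qed
  from R0.F_mult[OF ore_const_in_E[OF assms] this] show ?thesis
    by (simp add: ore_const_def smult_monom)
qed

sublocale R: affine_algebra k \<eta>\<^sub>R R S\<^sub>R
proof unfold_locales
  have "p \<in> (\<Union>m. E m)" for p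
  proof -
    have "\<exists>t. Polynomial.monom (Polynomial.coeff p i) i \<in> E t" for i
      using A.exhausting monom_in_E[of "Polynomial.coeff p i" _ i] by (metis UNIV_I UN_E ring_of_type_algebra_simps(1))
    then obtain t where t: "\<And>i. Polynomial.monom (Polynomial.coeff p i) i \<in> E (t i)"
      by metis
    define T where "T = Max (t ` {..Polynomial.degree p})"
    have "Polynomial.monom (Polynomial.coeff p i) i \<in> E T" if "i \<in> {..Polynomial.degree p}" for i
      using that t[of i] R0.F_mono[of "t i" T] by (auto simp: T_def)
    hence "(\<Sum>i\<le>Polynomial.degree p. Polynomial.monom (Polynomial.coeff p i) i) \<in> E T"
      by (rule sum_in_E)
    thus ?thesis
      by (auto simp: poly_as_sum_of_monoms)
  qed
  thus "(\<Union>m. E m) = carrier R" by auto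
qed

text \<open>
  If \<open>\<delta>\<close> maps the finitely many generators into \<open>A\<^sub>r\<close>, then by the Leibniz rule it raises the
  degree of every product of generators by at most \<open>r\<close>.
\<close>

lemma \<delta>_bounded: "\<exists>r. \<forall>m. \<delta> ` A.F m \<subseteq> A.F (m + r)"
proof -
  obtain r where r: "\<delta> ` S \<subseteq> A.F r"
    using A.finite_sub_F[of "\<delta> ` S"] A.S by auto
  have "A.F m \<subseteq> {a \<in> A.F m. \<delta> a \<in> A.F (m + r)}" for m
  proof (rule A.F_least_filtration)
    show "\<eta> ` carrier k \<subseteq> {a \<in> A.F 0. \<delta> a \<in> A.F (0 + r)}"
      using F_sub by auto
    show "kA.reg.ksubspace {a \<in> A.F m. \<delta> a \<in> A.F (m + r)}" for m
      unfolding kA.reg.ksubspace_iff A.regular_simps using F_sub by (auto simp: \<delta>_add \<delta>_mult)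
    fix m a s assume a: "a \<in> {a \<in> A.F m. \<delta> a \<in> A.F (m + r)}" and s: "s \<in> S"
    have "s \<in> A.F 1" "\<delta> s \<in> A.F r"
      using s r A.S_sub_F1 by auto
    hence "a * s \<in> A.F (m + 1)" "\<delta> a * s \<in> A.F (m + r + 1)" "a * \<delta> s \<in> A.F (m + r)"
      using a F_mult' by blast+
    thus "a \<otimes>\<^bsub>A\<^esub> s \<in> {a \<in> A.F (Suc m). \<delta> a \<in> A.F (Suc m + r)}"
      using A.F_mono[of "m + r" "Suc (m + r)"] by (auto simp: \<delta>_mult simp del: alg_filtration.simps intro: F_sub(1))
  qed
  thus ?thesis by blast
qed

text \<open>
  The polynomials of weighted degree at most \<open>mw\<close> and of degree at most \<open>m\<close> in \<open>x\<close>, where \<open>x\<close> has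
  weight \<open>w\<close> and the elements of \<open>A\<^sub>i\<close> have weight \<open>i\<close>.
\<close>

definition weighted :: "nat \<Rightarrow> nat \<Rightarrow> 'a Polynomial.poly set" where
  "weighted w m = {p. \<forall>i. if i \<le> m then Polynomial.coeff p i \<in> A.F ((m - i) * w)
     else Polynomial.coeff p i = 0}"

text \<open>
  With \<open>w = r + 1\<close>, where \<open>\<delta>\<close> raises the degree by at most \<open>r\<close>, both terms of \<open>xa = ax + \<delta>(a)\<close>
  have weight at most that of \<open>a\<close> plus \<open>w\<close>, so left multiplication by \<open>x\<close> raises the weight by at
  most \<open>w\<close>.
\<close>

lemma E_weighted: "\<exists>w. \<forall>m. E m \<subseteq> weighted w m"
proof -
  obtain r where r: "\<And>m a. a \<in> A.F m \<Longrightarrow> \<delta> a \<in> A.F (m + r)"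
    using \<delta>_bounded by blast
  define w where "w = Suc r"
  let ?G = "weighted w"
  have G_add: "p + q \<in> ?G m" if "p \<in> ?G m" "q \<in> ?G m" for p q m
    using that by (auto simp: weighted_def intro: F_sub)
  have G_zero: "0 \<in> ?G m" for m
    by (auto simp: weighted_def intro: F_sub)
  have G_smult: "Polynomial.smult a q \<in> ?G (u + t)" if a: "a \<in> A.F (u * w)" and q: "q \<in> ?G t" for a q u t
    unfolding weighted_def
  proof (intro CollectI allI)
    fix i
    show "if i \<le> u + t then Polynomial.coeff (Polynomial.smult a q) i \<in> A.F ((u + t - i) * w)
        else Polynomial.coeff (Polynomial.smult a q) i = 0"
    proof (cases "i \<le> t")
      case True
      hence "u * w + (t - i) * w = (u + t - i) * w"
        by (simp add: add_mult_distrib[symmetric])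
      with True q F_mult'[OF a, of "Polynomial.coeff q i" "(t - i) * w"] show ?thesis
        by (auto simp: weighted_def)
    next
      case False
      with q show ?thesis by (auto simp: weighted_def F_sub)
    qed
  qed
  have G_lmult: "ore_lmult_x \<delta> q \<in> ?G (Suc t)" if q: "q \<in> ?G t" for q t
    unfolding weighted_def
  proof (intro CollectI allI)
    fix j
    have cases: "j \<le> t \<or> j = Suc t \<or> j > Suc t" by arith
    have 1: "(if j = 0 then 0 else Polynomial.coeff q (j - 1)) \<in> A.F ((Suc t - j) * w)" if "j \<le> Suc t"
      using q that by (cases j) (auto simp: weighted_def F_sub)
    have 2: "\<delta> (Polynomial.coeff q j) \<in> A.F ((Suc t - j) * w)" if "j \<le> t"
    proof -
      have "\<delta> (Polynomial.coeff q j) \<in> A.F ((t - j) * w + r)"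
        using q that by (intro r) (auto simp: weighted_def)
      moreover have "(t - j) * w + r \<le> (Suc t - j) * w"
        using that by (simp add: Suc_diff_le w_def)
      ultimately show ?thesis
        using A.F_mono by blast
    qed
    have 3: "Polynomial.coeff q j = 0" if "j > t"
      using q that by (auto simp: weighted_def dest: spec[of _ j])
    have 4: "Polynomial.coeff q (j - 1) = 0" if "j > Suc t"
      using q that by (auto simp: weighted_def dest: spec[of _ "j - 1"])
    show "if j \<le> Suc t then Polynomial.coeff (ore_lmult_x \<delta> q) j \<in> A.F ((Suc t - j) * w)
        else Polynomial.coeff (ore_lmult_x \<delta> q) j = 0"
      using cases
    proof (elim disjE)
      assume "j \<le> t"
      with F_sub(1)[OF 1 2] show ?thesis by (simp add: coeff_ore_lmult_x)
    next
      assume "j = Suc t"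
      with 1 3 show ?thesis by (simp add: coeff_ore_lmult_x)
    next
      assume "j > Suc t"
      with 3 4 show ?thesis by (simp add: coeff_ore_lmult_x)
    qed
  qed
  have G_step: "ore_mult \<delta> p s \<in> ?G (Suc m)" if p: "p \<in> ?G m" and s: "s \<in> ?G 1" for p s m
  proof -
    have x_pow: "(ore_lmult_x \<delta> ^^ i) s \<in> ?G (Suc i)" for i
      using s G_lmult by (induction i) auto
    have "Polynomial.smult (Polynomial.coeff p i) ((ore_lmult_x \<delta> ^^ i) s) \<in> ?G (Suc m)" for i
    proof (cases "i \<le> m")
      case True
      with p have "Polynomial.coeff p i \<in> A.F ((m - i) * w)"
        by (auto simp: weighted_def)
      from G_smult[OF this x_pow[of i]] True show ?thesis by simp
    next
      case False
      with p have "Polynomial.coeff p i = 0"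
        by (auto simp: weighted_def)
      thus ?thesis using G_zero by simp
    qed
    hence "(\<Sum>i\<in>I. Polynomial.smult (Polynomial.coeff p i) ((ore_lmult_x \<delta> ^^ i) s)) \<in> ?G (Suc m)" for I
      by (induction I rule: infinite_finite_induct) (auto simp: G_zero G_add)
    thus ?thesis by (simp add: ore_mult_def)
  qed
  have S_weighted: "S\<^sub>R \<subseteq> ?G 1"
  proof -
    have "A.F 1 \<subseteq> A.F w" by (intro A.F_mono) (simp add: w_def)
    hence "ore_const s \<in> ?G 1" if "s \<in> S" for s
      using that A.S_sub_F1 by (auto simp: weighted_def ore_const_def coeff_pCons split: nat.splits
          simp del: alg_filtration.simps intro: F_sub(2))
    moreover have "\<xi> \<in> ?G 1"
      using A.one_in_F[of 0] F_sub(2)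
      by (auto simp: weighted_def coeff_pCons le_Suc_eq split: nat.splits)
    ultimately show ?thesis by (auto simp: S\<^sub>R_def)
  qed
  have "E m \<subseteq> ?G m" for m
  proof (rule R0.F_least_filtration)
    show "\<eta>\<^sub>R ` carrier k \<subseteq> ?G 0"
      by (auto simp: weighted_def ore_const_def coeff_pCons split: nat.splits)
    show "kR.reg.ksubspace (?G m)" for m
      unfolding kR.reg.ksubspace_iff R0.regular_simps
    proof (intro conjI ballI)
      fix c p assume "p \<in> ?G m"
      moreover have "\<eta> c \<in> A.F (0 * w)" by simp
      ultimately show "p \<otimes>\<^bsub>R\<^esub> \<eta>\<^sub>R c \<in> ?G m"
        using G_smult[of "\<eta> c" 0 p m] by (simp add: ore_mult_scalar)
    qed (auto simp: G_add G_zero)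
    show "p \<otimes>\<^bsub>R\<^esub> s \<in> ?G (Suc m)" if "p \<in> ?G m" "s \<in> S\<^sub>R" for m p s
      using G_step[OF that(1), of s] that(2) S_weighted by auto
  qed
  thus ?thesis by blast
qed

end

section \<open>The growth of the induced module\<close>

locale ore_affine_module = ore_affine \<eta> \<delta> S +
    N: affine_algebra_module "ring_of_type_algebra" \<eta> "ring_of_type_algebra" S N V
  for \<eta> :: "'k::field \<Rightarrow> 'a::comm_ring_1" and \<delta> :: "'a \<Rightarrow> 'a" and S :: "'a set"
    and N :: "('a, 'b) rmodule" and V :: "'b set"
begin

sublocale tensor: ring_extension_tensor A R N ore_const
  by (intro ring_extension_tensor.intro ring_extension_tensor_axioms.intro N.right_module_axioms
      ore_ring ore_const_hom)

abbreviation T where "T \<equiv> tensor_rmodule A ore_const R N"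

sublocale T: algebra_module k \<eta>\<^sub>R R T
  by (intro algebra_module.intro kR.central_algebra_axioms tensor.right_module_T)

lemma N_simps:
  "v \<in> carrier N \<Longrightarrow> v \<triangleleft>\<^bsub>N\<^esub> a \<in> carrier N"
  "v \<in> carrier N \<Longrightarrow> v \<triangleleft>\<^bsub>N\<^esub> (a * b) = v \<triangleleft>\<^bsub>N\<^esub> a \<triangleleft>\<^bsub>N\<^esub> b"
  "v \<in> carrier N \<Longrightarrow> v \<triangleleft>\<^bsub>N\<^esub> (a + b) = v \<triangleleft>\<^bsub>N\<^esub> a \<oplus>\<^bsub>N\<^esub> v \<triangleleft>\<^bsub>N\<^esub> b"
  "v \<in> carrier N \<Longrightarrow> v \<triangleleft>\<^bsub>N\<^esub> 1 = v"
  "v \<in> carrier N \<Longrightarrow> v \<triangleleft>\<^bsub>N\<^esub> 0 = \<zero>\<^bsub>N\<^esub>"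
  "u \<in> carrier N \<Longrightarrow> v \<in> carrier N \<Longrightarrow> (u \<oplus>\<^bsub>N\<^esub> v) \<triangleleft>\<^bsub>N\<^esub> a = u \<triangleleft>\<^bsub>N\<^esub> a \<oplus>\<^bsub>N\<^esub> v \<triangleleft>\<^bsub>N\<^esub> a"
  using N.ract_closed[of v a] N.ract_assoc[of v a b] N.ract_add_right[of v a b] N.ract_one[of v]
    N.ract_zero_right[of v] N.ract_add_left[of u v a] by simp_all

text \<open>
  The coordinate map \<open>v \<otimes> p \<mapsto> v p\<^sub>j\<close>, of which the universal property asserts the existence.
\<close>

definition proj :: "nat \<Rightarrow> ('b \<times> 'a Polynomial.poly \<Rightarrow>\<^sub>0 int) set \<Rightarrow> 'b" where
  "proj j = (SOME g. g \<in> carrier T \<rightarrow> carrier N \<and>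
     (\<forall>s\<in>carrier T. \<forall>t\<in>carrier T. g (s \<oplus>\<^bsub>T\<^esub> t) = g s \<oplus>\<^bsub>N\<^esub> g t) \<and>
     (\<forall>v\<in>carrier N. \<forall>p. g (tensor.pure v p) = v \<triangleleft>\<^bsub>N\<^esub> Polynomial.coeff p j))"

definition embed :: "nat \<Rightarrow> 'b \<Rightarrow> ('b \<times> 'a Polynomial.poly \<Rightarrow>\<^sub>0 int) set" where
  "embed j v = tensor.pure v (Polynomial.monom 1 j)"

lemma proj:
  "t \<in> carrier T \<Longrightarrow> proj j t \<in> carrier N"
  "s \<in> carrier T \<Longrightarrow> t \<in> carrier T \<Longrightarrow> proj j (s \<oplus>\<^bsub>T\<^esub> t) = proj j s \<oplus>\<^bsub>N\<^esub> proj j t"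
  "v \<in> carrier N \<Longrightarrow> proj j (tensor.pure v p) = v \<triangleleft>\<^bsub>N\<^esub> Polynomial.coeff p j"
proof -
  obtain g where g: "g \<in> carrier T \<rightarrow> carrier N"
    "\<And>s t. s \<in> carrier T \<Longrightarrow> t \<in> carrier T \<Longrightarrow> g (s \<oplus>\<^bsub>T\<^esub> t) = g s \<oplus>\<^bsub>N\<^esub> g t"
    "\<And>v p. v \<in> carrier N \<Longrightarrow> p \<in> carrier R \<Longrightarrow> g (tensor.pure v p) = v \<triangleleft>\<^bsub>N\<^esub> Polynomial.coeff p j"
    by (rule tensor.tensor_universal[OF N.Q.abelian_group_axioms,
        of "\<lambda>v p. v \<triangleleft>\<^bsub>N\<^esub> Polynomial.coeff p j"])
       (auto simp: N_simps ore_const_def)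
  hence "\<exists>g. g \<in> carrier T \<rightarrow> carrier N \<and>
     (\<forall>s\<in>carrier T. \<forall>t\<in>carrier T. g (s \<oplus>\<^bsub>T\<^esub> t) = g s \<oplus>\<^bsub>N\<^esub> g t) \<and>
     (\<forall>v\<in>carrier N. \<forall>p. g (tensor.pure v p) = v \<triangleleft>\<^bsub>N\<^esub> Polynomial.coeff p j)"
    by (intro exI[of _ g]) auto
  from someI_ex[OF this, folded proj_def] show
    "t \<in> carrier T \<Longrightarrow> proj j t \<in> carrier N"
    "s \<in> carrier T \<Longrightarrow> t \<in> carrier T \<Longrightarrow> proj j (s \<oplus>\<^bsub>T\<^esub> t) = proj j s \<oplus>\<^bsub>N\<^esub> proj j t"
    "v \<in> carrier N \<Longrightarrow> proj j (tensor.pure v p) = v \<triangleleft>\<^bsub>N\<^esub> Polynomial.coeff p j"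
    by auto
qed

lemma pure_closed: "v \<in> carrier N \<Longrightarrow> tensor.pure v p \<in> carrier T"
  by (simp add: tensor.pure_closed)

lemma pure_ract: "v \<in> carrier N \<Longrightarrow> tensor.pure v p \<triangleleft>\<^bsub>T\<^esub> q = tensor.pure v (ore_mult \<delta> p q)"
  using tensor.pure_ract[of v p q] by simp

lemma pure_const: "v \<in> carrier N \<Longrightarrow> tensor.pure (v \<triangleleft>\<^bsub>N\<^esub> a) p = tensor.pure v (Polynomial.smult a p)"
  using tensor.pure_balanced[of v a p] by (simp add: ore_const_def)

lemma pure_scalar:
  "v \<in> carrier N \<Longrightarrow> tensor.pure (v \<triangleleft>\<^bsub>N\<^esub> \<eta> c) p = tensor.pure v p \<triangleleft>\<^bsub>T\<^esub> \<eta>\<^sub>R c"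
  by (simp add: pure_const pure_ract ore_mult_scalar)

lemma proj_zero: "proj j \<zero>\<^bsub>T\<^esub> = \<zero>\<^bsub>N\<^esub>"
  using proj(2)[of "\<zero>\<^bsub>T\<^esub>" "\<zero>\<^bsub>T\<^esub>" j] proj(1)[of "\<zero>\<^bsub>T\<^esub>" j] by (simp add: N.Q.add.l_cancel_one')

lemma proj_scalar: "t \<in> carrier T \<Longrightarrow> proj j (t \<triangleleft>\<^bsub>T\<^esub> \<eta>\<^sub>R c) = proj j t \<triangleleft>\<^bsub>N\<^esub> \<eta> c"
proof (induction t rule: tensor.tensor_induct)
  case zero
  show ?case
    using T.ract_zero[of "\<eta>\<^sub>R c"] N.ract_zero[of "\<eta> c"] by (simp add: proj_zero)
next
  case (pure v p)
  thus ?case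
    by (simp add: pure_ract ore_mult_scalar proj N_simps mult.commute[of "\<eta> c"])
next
  case (add s t)
  thus ?case
    using T.ract_closed[of s "\<eta>\<^sub>R c"] T.ract_closed[of t "\<eta>\<^sub>R c"]
    by (simp add: T.ract_add_left proj N_simps)
qed

text \<open>
  Since \<open>v \<otimes> p = \<Sum>\<^sub>j v p\<^sub>j \<otimes> x\<^sup>j\<close>, every element is the sum of its components, of which almost
  all vanish.
\<close>

lemma expand_in:
  assumes X: "T.ksubspace Y" and t: "t \<in> carrier T" and comp: "\<And>j. embed j (proj j t) \<in> Y"
  shows "t \<in> Y"
proof -
  define part where "part n t = rec_nat \<zero>\<^bsub>T\<^esub> (\<lambda>j s. s \<oplus>\<^bsub>T\<^esub> embed j (proj j t)) n" for n t
  have part_simps [simp]: "part 0 t = \<zero>\<^bsub>T\<^esub>" "part (Suc n) t = part n t \<oplus>\<^bsub>T\<^esub> embed n (proj n t)" for n t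
    by (simp_all add: part_def)
  have embed_closed: "embed j (proj j t) \<in> carrier T" if "t \<in> carrier T" for j t
    using that by (simp add: embed_def pure_closed proj)
  have part_closed: "part n t \<in> carrier T" if "t \<in> carrier T" for n t
    using that by (induction n) (simp_all add: embed_closed)
  have part_add: "part n (s \<oplus>\<^bsub>T\<^esub> t) = part n s \<oplus>\<^bsub>T\<^esub> part n t"
    if "s \<in> carrier T" "t \<in> carrier T" for n s t
  proof (induction n)
    case (Suc n)
    have "embed n (proj n (s \<oplus>\<^bsub>T\<^esub> t)) = embed n (proj n s) \<oplus>\<^bsub>T\<^esub> embed n (proj n t)"
      using that by (simp add: embed_def proj tensor.pure_add_left)
    with Suc that show ?case
      by (simp add: embed_closed part_closed tensor.T.a_ac)
  qed simp
  have part_zero: "part n \<zero>\<^bsub>T\<^esub> = \<zero>\<^bsub>T\<^esub>" for n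
    by (induction n) (simp_all add: proj_zero embed_def tensor.pure_zero_left)
  have part_pure: "part n (tensor.pure v p) =
      tensor.pure v (\<Sum>j<n. Polynomial.monom (Polynomial.coeff p j) j)" if "v \<in> carrier N" for n v p
  proof (induction n)
    case 0
    show ?case using tensor.pure_zero_right[OF that] by simp
  next
    case (Suc n)
    with that tensor.pure_add_right[OF that] show ?case
      by (simp add: proj embed_def pure_const smult_monom)
  qed
  have "\<exists>n\<^sub>0. \<forall>n\<ge>n\<^sub>0. part n t = t"
    using t
  proof (induction t rule: tensor.tensor_induct)
    case zero
    show ?case by (simp add: part_zero)
  next
    case (pure v p)
    have "(\<Sum>j<n. Polynomial.monom (Polynomial.coeff p j) j) = p"
      if "n \<ge> Suc (Polynomial.degree p)" for n
    proof (rule poly_eqI)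
      fix i
      show "Polynomial.coeff (\<Sum>j<n. Polynomial.monom (Polynomial.coeff p j) j) i = Polynomial.coeff p i"
        using that by (auto simp: Polynomial.coeff_sum Polynomial.coeff_eq_0 sum.delta)
    qed
    with pure show ?case
      by (intro exI[of _ "Suc (Polynomial.degree p)"]) (simp add: part_pure)
  next
    case (add s t)
    then obtain n\<^sub>1 n\<^sub>2 where "\<forall>n\<ge>n\<^sub>1. part n s = s" "\<forall>n\<ge>n\<^sub>2. part n t = t" by blast
    with add show ?case
      by (intro exI[of _ "max n\<^sub>1 n\<^sub>2"]) (simp add: part_add)
  qed
  then obtain n where "part n t = t" by blast
  moreover have "part n t \<in> Y" for n
    using X comp by (induction n) (auto simp: T.ksubspace_iff)
  ultimately show ?thesis by metis
qed

sublocale copies: direct_sum_copies k "scalar_space \<eta>\<^sub>R T" "scalar_space \<eta> N" proj embed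
proof (intro direct_sum_copies.intro direct_sum_copies_axioms.intro)
  show "vectorspace k (scalar_space \<eta>\<^sub>R T)" "vectorspace k (scalar_space \<eta> N)"
    by (rule T.scalar_vectorspace N.scalar_vectorspace)+
  show "proj j \<in> module_hom k (scalar_space \<eta>\<^sub>R T) (scalar_space \<eta> N)" for j
    by (simp add: module_hom_def T.scalar_space_simps N.scalar_space_simps proj proj_scalar)
  show "embed j \<in> module_hom k (scalar_space \<eta> N) (scalar_space \<eta>\<^sub>R T)" for j
    by (simp add: module_hom_def T.scalar_space_simps N.scalar_space_simps embed_def pure_closed
        tensor.pure_add_left pure_scalar)
  show "proj i (embed j u) = (if i = j then u else \<zero>\<^bsub>scalar_space \<eta> N\<^esub>)"
    if "u \<in> carrier (scalar_space \<eta> N)" for i j u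
    using that by (auto simp: N.scalar_space_simps embed_def proj N_simps)
  show "t = \<zero>\<^bsub>scalar_space \<eta>\<^sub>R T\<^esub>" if "t \<in> carrier (scalar_space \<eta>\<^sub>R T)"
    "\<And>j. proj j t = \<zero>\<^bsub>scalar_space \<eta> N\<^esub>" for t
  proof -
    have "T.ksubspace {\<zero>\<^bsub>T\<^esub>}"
      using T.ract_zero[of "\<eta>\<^sub>R _"] by (auto simp: T.ksubspace_iff)
    thus ?thesis
      using that expand_in[of "{\<zero>\<^bsub>T\<^esub>}" t]
      by (simp add: T.scalar_space_simps N.scalar_space_simps embed_def tensor.pure_zero_left)
  qed
qed

lemma kdim_initial:
  assumes "finite_dim_subspace k \<eta> N U"
  shows "finite_dim_subspace k \<eta>\<^sub>R T (copies.initial m U)"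
    and "kdim k \<eta>\<^sub>R T (copies.initial m U) = m * kdim k \<eta> N U"
  using assms copies.initial_dim[of U m] copies.initial_subspace[of U m]
  by (simp_all add: finite_dim_subspace_def kdim_def)

lemma ksubspace_pure_preimage:
  assumes "T.ksubspace Y"
  shows "N.ksubspace {v \<in> carrier N. tensor.pure v p \<in> Y}"
  using assms
  by (auto simp: N.ksubspace_iff T.ksubspace_iff tensor.pure_add_left tensor.pure_zero_left
      pure_scalar N_simps)

text \<open>
  The vectors \<open>b \<otimes> 1\<close>, for \<open>b\<close> in a finite spanning set of \<open>V\<close>, generate the induced module; its growth
  function \<open>D\<close> is bounded by that of \<open>N\<close> through the two inclusions of graded subspaces.
\<close>

theorem gkdim_tensor: "gkdim k \<eta>\<^sub>R R T = gkdim k \<eta> A N + 1"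
proof -
  obtain B where B: "finite B" "B \<subseteq> carrier N" "N.span B = V"
    using N.V(1) N.finite_dim_subspace_iff by auto
  have BV: "B \<subseteq> V" using B N.span_superset by auto
  define V' where "V' = T.span ((\<lambda>b. tensor.pure b 1) ` B)"
  have gens: "(\<lambda>b. tensor.pure b 1) ` B \<subseteq> carrier T"
    using B by (auto simp: pure_closed)
  have V': "finite_dim_subspace k \<eta>\<^sub>R T V'" "V' \<subseteq> carrier T" "\<And>b. b \<in> B \<Longrightarrow> tensor.pure b 1 \<in> V'"
    using T.finite_dim_subspace_iff B gens T.span_closed[OF gens] T.span_superset[OF gens]
    by (auto simp: V'_def)
  \<comment> \<open>Elements \<open>v\<close> of \<open>V\<close> may be replaced by the spanning vectors in \<open>B\<close>.\<close>
  have pure_in: "tensor.pure (v \<triangleleft>\<^bsub>N\<^esub> a) p \<in> Y"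
    if Y: "T.ksubspace Y" and v: "v \<in> V" and gen: "\<And>b. b \<in> B \<Longrightarrow> tensor.pure b (Polynomial.smult a p) \<in> Y"
    for Y v a p
  proof -
    have "N.span B \<subseteq> {v \<in> carrier N. tensor.pure v (Polynomial.smult a p) \<in> Y}"
      using B gen by (intro N.span_least ksubspace_pure_preimage Y) auto
    thus ?thesis
      using v B by (auto simp: pure_const)
  qed
  have "generating_subspace k \<eta>\<^sub>R R T V'"
    unfolding generating_subspace_def
  proof (intro conjI V'(1) antisym)
    let ?Y = "T.prod V' (carrier R)"
    have Y: "T.ksubspace ?Y"
      using V' by (intro T.prod_subspace) auto
    have "tensor.pure b p \<in> ?Y" if "b \<in> B" for b p
    proof -
      have "tensor.pure b 1 \<triangleleft>\<^bsub>T\<^esub> p \<in> ?Y"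
        using V' that by (intro T.prodI) auto
      thus ?thesis using that B by (simp add: pure_ract subset_iff)
    qed
    hence "tensor.pure (v \<triangleleft>\<^bsub>N\<^esub> a) p \<in> ?Y" if "v \<in> V" for v a p
      using pure_in[OF Y that] by blast
    hence "N.prod V (carrier A) \<subseteq> {v \<in> carrier N. tensor.pure v p \<in> ?Y}" for p
      using N.V by (intro N.prod_least ksubspace_pure_preimage Y) (auto simp: N_simps)
    hence pure_Y: "tensor.pure v p \<in> ?Y" if "v \<in> carrier N" for v p
      using that N.gen_Q by (auto simp: generating_subspace_def)
    show "carrier T \<subseteq> ?Y"
    proof
      fix t assume "t \<in> carrier T"
      thus "t \<in> ?Y"
        using Y by (induction t rule: tensor.tensor_induct) (auto simp: pure_Y[simplified] T.ksubspace_iff)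
    qed
    show "?Y \<subseteq> carrier T"
      using V' by (intro T.prod_closed) auto
  qed
  then interpret G: affine_algebra_module k \<eta>\<^sub>R R S\<^sub>R T V'
    by unfold_locales
  obtain w where w: "\<And>m. E m \<subseteq> weighted w m"
    using E_weighted by blast
  define U where "U m = N.prod V (A.F m)" for m
  define d where "d m = kdim k \<eta> N (U m)" for m
  define D where "D m = kdim k \<eta>\<^sub>R T (T.prod V' (E m))" for m
  have U: "finite_dim_subspace k \<eta> N (U m)" "N.ksubspace (U m)" for m
    using N.finite_dim_prod_F by (auto simp: U_def finite_dim_subspace_def)
  have d_mono: "d m \<le> d n" if "m \<le> n" for m n
    unfolding d_def using U N.prod_F_mono[OF that] by (intro N.kdim_mono) (auto simp: U_def)
  have upper: "D m \<le> Suc m * d (m * w)" for m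
  proof -
    let ?W = "copies.initial (Suc m) (U (m * w))"
    have W: "finite_dim_subspace k \<eta>\<^sub>R T ?W" "T.ksubspace ?W"
      using kdim_initial(1)[OF U(1)] by (auto simp: finite_dim_subspace_def)
    have "T.prod V' (E m) \<subseteq> ?W"
    proof (rule T.prod_least[OF W(2)])
      fix v e assume v: "v \<in> V'" and e: "e \<in> E m"
      have "V' \<subseteq> {v \<in> carrier T. v \<triangleleft>\<^bsub>T\<^esub> e \<in> ?W}"
        unfolding V'_def
      proof (intro T.span_least T.ksubspace_preimage_ract W(2) subsetI)
        fix x assume "x \<in> (\<lambda>b. tensor.pure b 1) ` B"
        then obtain b where b: "b \<in> B" "x = tensor.pure b 1" "b \<in> carrier N" "b \<in> V"
          using B BV by auto
        have "proj j (tensor.pure b e) \<in> (if j < Suc m then U (m * w) else {\<zero>\<^bsub>N\<^esub>})" for j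
        proof (cases "j \<le> m")
          case True
          hence "Polynomial.coeff e j \<in> A.F ((m - j) * w)"
            using w[of m] e by (auto simp: weighted_def)
          moreover have "(m - j) * w \<le> m * w" by simp
          ultimately have "Polynomial.coeff e j \<in> A.F (m * w)"
            using A.F_mono by blast
          hence "b \<triangleleft>\<^bsub>N\<^esub> Polynomial.coeff e j \<in> U (m * w)"
            unfolding U_def using b N.V by (intro N.prodI) auto
          with True b show ?thesis by (simp add: proj)
        next
          case False
          hence "Polynomial.coeff e j = 0"
            using w[of m] e by (auto simp: weighted_def)
          with False b show ?thesis by (simp add: proj N_simps)
        qed
        hence "tensor.pure b e \<in> ?W"
          using b unfolding copies.initial_def T.scalar_space_simps N.scalar_space_simps
          by (intro CollectI conjI allI) (auto simp: pure_closed)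
        thus "x \<in> {v \<in> carrier T. v \<triangleleft>\<^bsub>T\<^esub> e \<in> ?W}"
          using b by (simp add: pure_ract pure_closed)
      qed simp
      with v show "v \<triangleleft>\<^bsub>T\<^esub> e \<in> ?W" by blast
    qed
    hence "D m \<le> kdim k \<eta>\<^sub>R T ?W"
      unfolding D_def by (intro T.kdim_mono G.finite_dim_prod_F W)
    thus ?thesis
      using kdim_initial(2)[OF U(1)] by (simp add: d_def)
  qed
  have lower: "Suc m * d m \<le> D (2 * m)" for m
  proof -
    let ?Y = "T.prod V' (E (2 * m))"
    have Y: "T.ksubspace ?Y"
      using V' R0.F_closed by (intro T.prod_subspace) auto
    have embed_U: "embed j u \<in> ?Y" if j: "j \<le> m" and u: "u \<in> U m" for j u
    proof -
      have "tensor.pure (v \<triangleleft>\<^bsub>N\<^esub> a) (Polynomial.monom 1 j) \<in> ?Y" if "v \<in> V" "a \<in> A.F m" for v a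
      proof (rule pure_in[OF Y that(1)])
        fix b assume b: "b \<in> B"
        have "Polynomial.monom a j \<in> E (2 * m)"
          using monom_in_E[OF that(2), of j] R0.F_mono[of "m + j" "2 * m"] j by auto
        hence "tensor.pure b 1 \<triangleleft>\<^bsub>T\<^esub> Polynomial.monom a j \<in> ?Y"
          using V' b by (intro T.prodI) auto
        thus "tensor.pure b (Polynomial.smult a (Polynomial.monom 1 j)) \<in> ?Y"
          using b B by (simp add: pure_ract smult_monom subset_iff)
      qed
      hence "U m \<subseteq> {u \<in> carrier N. tensor.pure u (Polynomial.monom 1 j) \<in> ?Y}"
        unfolding U_def using N.V by (intro N.prod_least ksubspace_pure_preimage Y) (auto simp: N_simps)
      with u show ?thesis by (auto simp: embed_def)
    qed
    have "copies.initial (Suc m) (U m) \<subseteq> ?Y"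
    proof
      fix t assume t: "t \<in> copies.initial (Suc m) (U m)"
      hence tT: "t \<in> carrier T"
        by (simp add: copies.initial_def T.scalar_space_simps)
      show "t \<in> ?Y"
      proof (rule expand_in[OF Y tT])
        fix j
        have "proj j t \<in> (if j < Suc m then U m else {\<zero>\<^bsub>N\<^esub>})"
          using t unfolding copies.initial_def N.scalar_space_simps by blast
        thus "embed j (proj j t) \<in> ?Y"
          using embed_U[of j "proj j t"] Y tensor.pure_zero_left
          by (cases "j \<le> m") (auto simp: embed_def T.ksubspace_iff)
      qed
    qed
    hence "kdim k \<eta>\<^sub>R T (copies.initial (Suc m) (U m)) \<le> D (2 * m)"
      unfolding D_def by (intro T.kdim_mono G.finite_dim_prod_F kdim_initial(1) U)
    thus ?thesis
      using kdim_initial(2)[OF U(1)] by (simp add: d_def)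
  qed
  have "gkdim k \<eta>\<^sub>R R T = limsup (\<lambda>m. log_dim m (D m))"
    unfolding G.gkdim_eq gkdim_wrt_def D_def ..
  also have "\<dots> = limsup (\<lambda>m. log_dim m (Suc m * d m))"
  proof (rule antisym)
    have "D m \<le> Suc ((w + 1) * m + 0) * d ((w + 1) * m + 0)" for m
    proof -
      have "D m \<le> Suc m * d (m * w)" by (rule upper)
      also have "\<dots> \<le> Suc ((w + 1) * m + 0) * d ((w + 1) * m + 0)"
        by (intro mult_le_mono d_mono) (auto simp: algebra_simps)
      finally show ?thesis .
    qed
    thus "limsup (\<lambda>m. log_dim m (D m)) \<le> limsup (\<lambda>m. log_dim m (Suc m * d m))"
      by (rule limsup_log_dim_reparam) (intro monoI mult_le_mono d_mono, auto)
    have "mono D"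
      unfolding D_def by (intro monoI T.kdim_mono G.finite_dim_prod_F G.prod_F_mono)
    with lower show "limsup (\<lambda>m. log_dim m (Suc m * d m)) \<le> limsup (\<lambda>m. log_dim m (D m))"
      by (intro limsup_log_dim_reparam[of _ D 2 0]) auto
  qed
  also have "\<dots> = limsup (\<lambda>m. log_dim m (d m)) + 1"
    by (rule limsup_log_dim_times_Suc)
  also have "limsup (\<lambda>m. log_dim m (d m)) = gkdim k \<eta> A N"
    unfolding N.gkdim_eq gkdim_wrt_def d_def U_def ..
  finally show ?thesis .
qed

end

section \<open>Laurent polynomial rings\<close>

lemma lconst_hom: "lconst \<in> ring_hom ring_of_type_algebra ring_of_type_algebra"
  by (rule ring_hom_memI) (simp_all add: lconst_def single_add mult_single)

lemma lpartial_lconst: "lpartial i (lconst c) = 0"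
  by (simp add: lpartial_def lconst_def)

definition lvars :: "('k::field, 'n::finite) laurent set" where
  "lvars = insert 1 (range lvar \<union> range (\<lambda>i. Poly_Mapping.single (- unit_exp i) 1))"

lemma central_algebra_laurent:
  "central_algebra (ring_of_type_algebra :: 'k::field ring) lconst
     (ring_of_type_algebra :: ('k, 'n::finite) laurent ring)"
  by (intro central_algebra.intro central_algebra_axioms.intro lconst_hom)
     (auto simp: mult.commute)

text \<open>
  Monomials are products of powers of the variables and of their inverses, so all of them lie in the
  subalgebra \<open>G\<close> exhausted by the powers of the generating space.
\<close>

lemma affine_algebra_laurent:
  "affine_algebra (ring_of_type_algebra :: 'k::field ring) lconst
     (ring_of_type_algebra :: ('k, 'n::finite) laurent ring) lvars"
proof -
  interpret A: central_algebra "ring_of_type_algebra :: 'k ring" lconst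
      "ring_of_type_algebra :: ('k, 'n) laurent ring"
    by (rule central_algebra_laurent)
  interpret A: algebra_filtration "ring_of_type_algebra :: 'k ring" lconst
      "ring_of_type_algebra :: ('k, 'n) laurent ring" lvars
    by unfold_locales (auto simp: lvars_def)
  define G where "G = (\<Union>m. A.F m)"
  have G_mult: "p * q \<in> G" if "p \<in> G" "q \<in> G" for p q
    using that A.F_mult by (fastforce simp: G_def)
  have G_add: "p + q \<in> G" if "p \<in> G" "q \<in> G" for p q
  proof -
    from that obtain s t where "p \<in> A.F s" "q \<in> A.F t"
      unfolding G_def by blast
    hence "p \<in> A.F (max s t)" "q \<in> A.F (max s t)"
      using A.F_mono[of s "max s t"] A.F_mono[of t "max s t"] by auto
    hence "p + q \<in> A.F (max s t)"
      using A.F_subspace[of "max s t"] unfolding A.reg.ksubspace_iff A.regular_simps by simp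
    thus ?thesis by (auto simp: G_def)
  qed
  have G_const: "lconst c \<in> G" for c
    by (auto simp: G_def intro!: exI[of _ 0])
  have G_one: "1 \<in> G"
    using A.one_in_F by (auto simp: G_def simp del: alg_filtration.simps)
  have G_vars: "p \<in> G" if "p \<in> lvars" for p
    using A.S_sub_F1 that unfolding G_def by blast
  have G_power: "Poly_Mapping.single (\<lambda>j. if j = i then int n else 0) 1 \<in> G \<and>
      Poly_Mapping.single (\<lambda>j. if j = i then - int n else 0) 1 \<in> G" for i :: 'n and n
  proof (induction n)
    case 0
    have "(\<lambda>j. if j = i then int 0 else 0) = 0" "(\<lambda>j. if j = i then - int 0 else 0) = 0"
      by (auto simp: fun_eq_iff)
    thus ?case using G_one by (simp only: single_one)
  next
    case (Suc n)
    have "lvar i \<in> G" "Poly_Mapping.single (- unit_exp i) 1 \<in> G"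
      by (auto intro!: G_vars simp: lvars_def)
    moreover have "unit_exp i + (\<lambda>j. if j = i then int n else 0) =
        (\<lambda>j. if j = i then int (Suc n) else 0)"
      "- unit_exp i + (\<lambda>j. if j = i then - int n else 0) =
        (\<lambda>j. if j = i then - int (Suc n) else 0)"
      by (auto simp: unit_exp_def fun_eq_iff)
    ultimately show ?case
      using G_mult[OF _ conjunct1[OF Suc], of "lvar i"]
        G_mult[OF _ conjunct2[OF Suc], of "Poly_Mapping.single (- unit_exp i) 1"]
      by (simp only: lvar_def mult_single mult_1_left)
  qed
  have G_var_power: "Poly_Mapping.single (\<lambda>j. if j = i then z else 0) 1 \<in> G" for i :: 'n and z :: int
  proof -
    obtain n where "z = int n \<or> z = - int n" by (meson int_cases2)
    with G_power[of i n] show ?thesis by (elim disjE) (simp_all cong: if_cong)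
  qed
  have G_monomial: "Poly_Mapping.single (\<lambda>j. if j \<in> I then e j else 0) 1 \<in> G"
    if "finite I" for I :: "'n set" and e
    using that
  proof (induction I rule: finite_induct)
    case empty
    show ?case using G_one by (simp flip: zero_fun_def single_one)
  next
    case (insert i I)
    have "(\<lambda>j. if j \<in> insert i I then e j else 0) =
        (\<lambda>j. if j = i then e i else 0) + (\<lambda>j. if j \<in> I then e j else 0)"
      using insert.hyps by (auto simp: fun_eq_iff)
    with G_mult[OF G_var_power[of i "e i"] insert.IH] show ?case
      by (simp add: mult_single)
  qed
  have "Poly_Mapping.single e c \<in> G" for e :: "'n \<Rightarrow> int" and c
    using G_mult[OF G_const[of c] G_monomial[of UNIV e]] by (simp add: lconst_def mult_single)
  note G_single = this
  have "p \<in> G" for p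
  proof (induction p rule: Poly_Mapping.update_induct)
    case const
    show ?case using G_const[of 0] by (simp add: lconst_def)
  next
    case (update f a b)
    have "Poly_Mapping.update a b f = f + Poly_Mapping.single a b"
      using update(1)
      by (intro poly_mapping_eqI)
         (auto simp: lookup_update lookup_add lookup_single in_keys_iff when_def)
    thus ?case using G_add[OF update(3) G_single] by simp
  qed
  thus ?thesis
    by unfold_locales (auto simp: G_def)
qed

theorem lemma3p1:
  fixes g :: "'n::finite \<Rightarrow> ('k::field, 'n) laurent"
    and \<delta> :: "('k, 'n) laurent \<Rightarrow> ('k, 'n) laurent"
    and k :: "'k ring"
    and Kn :: "('k, 'n) laurent ring"
    and R :: "('k, 'n) laurent Polynomial.poly ring"
    and M :: "(('k, 'n) laurent Polynomial.poly, 'm) rmodule"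
    and N :: "'m set"
    and N\<^sub>K :: "(('k, 'n) laurent, 'm) rmodule"
  assumes g: "\<And>i. \<exists>a b. g i = lconst a * lvar i + lconst b"
    and \<delta>: "\<delta> = (\<lambda>p. \<Sum>i\<in>UNIV. g i * lpartial i p)"
    and k: "k = ring_of_type_algebra"
    and Kn: "Kn = ring_of_type_algebra"
    and R: "R = ore_extension \<delta>"
    and simple: "simple_ring R"
    and M: "right_module R M"
    and N: "cyclic_right_submodule Kn N (restrict_scalars ore_const M)"
    and N\<^sub>K: "N\<^sub>K = (restrict_scalars ore_const M)\<lparr>carrier := N\<rparr>"
  shows "gkdim k (\<lambda>c. ore_const (lconst c)) R (tensor_rmodule Kn ore_const R N\<^sub>K) =
         gkdim k lconst Kn N\<^sub>K + 1"
proof -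
  interpret ore_derivation lconst \<delta>
  proof (rule ore_derivation.intro)
    show "ring (ore_extension \<delta>)"
      using simple by (simp add: simple_ring_def R)
  qed (simp_all add: lconst_hom \<delta> lpartial_lconst)
  interpret M: right_module R M by (rule M)
  interpret Kn: affine_algebra k lconst Kn lvars
    unfolding k Kn by (rule affine_algebra_laurent)
  have M_ract: "v \<triangleleft>\<^bsub>M\<^esub> p \<in> carrier M" "v \<triangleleft>\<^bsub>M\<^esub> 1 = v"
    "v \<triangleleft>\<^bsub>M\<^esub> (p + q) = v \<triangleleft>\<^bsub>M\<^esub> p \<oplus>\<^bsub>M\<^esub> v \<triangleleft>\<^bsub>M\<^esub> q"
    "v \<triangleleft>\<^bsub>M\<^esub> ore_mult \<delta> p q = v \<triangleleft>\<^bsub>M\<^esub> p \<triangleleft>\<^bsub>M\<^esub> q"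
    "u \<in> carrier M \<Longrightarrow> (u \<oplus>\<^bsub>M\<^esub> v) \<triangleleft>\<^bsub>M\<^esub> p = u \<triangleleft>\<^bsub>M\<^esub> p \<oplus>\<^bsub>M\<^esub> v \<triangleleft>\<^bsub>M\<^esub> p"
    if "v \<in> carrier M" for u v p q
    using that M.ract_closed[of v p] M.ract_one[of v] M.ract_add_right[of v p q]
      M.ract_assoc[of v p q] M.ract_add_left[of u v p] by (simp_all add: R)
  have N_simps: "carrier N\<^sub>K = N" "\<zero>\<^bsub>N\<^sub>K\<^esub> = \<zero>\<^bsub>M\<^esub>" "u \<oplus>\<^bsub>N\<^sub>K\<^esub> v = u \<oplus>\<^bsub>M\<^esub> v"
    "u \<triangleleft>\<^bsub>N\<^sub>K\<^esub> a = u \<triangleleft>\<^bsub>M\<^esub> ore_const a" for u v a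
    by (simp_all add: N\<^sub>K restrict_scalars_def)
  have sub: "\<zero>\<^bsub>M\<^esub> \<in> N" "\<And>u v. u \<in> N \<Longrightarrow> v \<in> N \<Longrightarrow> u \<oplus>\<^bsub>M\<^esub> v \<in> N" "N \<subseteq> carrier M"
    and N_ract: "\<And>v a. v \<in> N \<Longrightarrow> v \<triangleleft>\<^bsub>M\<^esub> ore_const a \<in> N"
    using N
    by (auto simp: cyclic_right_submodule_def right_submodule_def restrict_scalars_def Kn subgroup_def)
  have N_neg: "\<ominus>\<^bsub>M\<^esub> v \<in> N" if "v \<in> N" for v
  proof -
    have v: "v \<in> carrier M" using that sub by auto
    have "v \<oplus>\<^bsub>M\<^esub> v \<triangleleft>\<^bsub>M\<^esub> ore_const (- 1) = v \<triangleleft>\<^bsub>M\<^esub> (1 + ore_const (- 1))"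
      using v by (simp add: M_ract)
    also have "1 + ore_const (- 1) = (0 :: ('k, 'n) laurent Polynomial.poly)"
      using ore_const_simps(1)[of 1 "- 1"] by simp
    also have "v \<triangleleft>\<^bsub>M\<^esub> 0 = \<zero>\<^bsub>M\<^esub>"
      using M_ract(3)[of v 0 0] M_ract(1)[of v 0] v by (simp add: M.Q.add.l_cancel_one')
    finally have "\<ominus>\<^bsub>M\<^esub> v = v \<triangleleft>\<^bsub>M\<^esub> ore_const (- 1)"
      using v M_ract(1) by (metis M.Q.minus_equality M.Q.a_comm)
    thus ?thesis using N_ract[OF that] by simp
  qed
  have "abelian_group N\<^sub>K"
  proof (rule abelian_groupI, unfold N_simps)
    show "\<exists>u\<in>N. u \<oplus>\<^bsub>M\<^esub> v = \<zero>\<^bsub>M\<^esub>" if "v \<in> N" for v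
      using N_neg[OF that] M.Q.l_neg[of v] that sub(3) by blast
  qed (use sub in \<open>auto simp: subset_iff M.Q.a_assoc intro: M.Q.a_comm\<close>)
  hence "right_module Kn N\<^sub>K"
    unfolding Kn
    by (intro right_module.intro right_module_axioms.intro ring_from_type_algebra, unfold N_simps)
       (use sub N_ract in \<open>auto simp: N_simps subset_iff M_ract
         ore_const_simps(4)[of _ _ \<delta>] simp del: ore_mult_const\<close>)
  then interpret NK: algebra_module k lconst Kn N\<^sub>K
    by (intro algebra_module.intro Kn.central_algebra_axioms)
  obtain v where v: "v \<in> N" "N = (\<lambda>a. v \<triangleleft>\<^bsub>N\<^sub>K\<^esub> a) ` carrier Kn"
    using N by (auto simp: cyclic_right_submodule_def N_simps restrict_scalars_def)
  have "generating_subspace k lconst Kn N\<^sub>K (NK.span {v})"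
    unfolding generating_subspace_def
  proof (intro conjI antisym)
    show "finite_dim_subspace k lconst N\<^sub>K (NK.span {v})"
      using NK.finite_dim_subspace_iff v by (auto simp: N_simps)
    have closed: "NK.span {v} \<subseteq> carrier N\<^sub>K" and "v \<in> NK.span {v}"
      using NK.span_closed[of "{v}"] NK.span_superset[of "{v}"] v by (auto simp: N_simps)
    thus "carrier N\<^sub>K \<subseteq> NK.prod (NK.span {v}) (carrier Kn)"
      using v NK.prodI[of v "NK.span {v}" _ "carrier Kn"] by (auto simp: N_simps)
    show "NK.prod (NK.span {v}) (carrier Kn) \<subseteq> carrier N\<^sub>K"
      using closed by (intro NK.prod_closed) auto
  qed
  hence "affine_algebra_module k lconst Kn lvars N\<^sub>K (NK.span {v})"
    by unfold_locales
  hence "ore_affine_module lconst \<delta> lvars N\<^sub>K (NK.span {v})"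
    using Kn.affine_algebra_axioms
    by (intro ore_affine_module.intro ore_affine.intro ore_derivation_axioms) (simp_all add: k Kn)
  from ore_affine_module.gkdim_tensor[OF this] show ?thesis
    by (simp add: k Kn R)
qed

end
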